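(* A 2-step nilpotent Lie algebra $\mathfrak{g}$ of dimension $n$ admits a flat pseudo-Euclidean metric of signature $(2,n-2)$ such that $\dim \big(Z(\mathfrak{g})\cap Z(\mathfrak{g})^\perp\big)=1$ if and only if $\mathfrak{g}$ is a trivial extension of $\mathcal{H}_3$ or $\mathfrak{g}$ is a trivial extension of $\mathrm{L}_6^4$. Furthermore, in the second case, for any such metric, $\mathfrak{g}$ can be written as a trivial extension of $\mathrm{L}_6^4$ in such a way that the restriction of the metric to $\mathrm{L}_6^4$ is given by $\langle\,,\rangle_0$: that is, $\mathfrak{g}=Z_1\oplus L$ with $Z_1\subset Z(\mathfrak{g})$ and $L$ a subalgebra having a basis $\{x_1,\dots,x_6\}$ whose only non-vanishing brackets are $[x_1,x_2]=x_5$, $[x_1,x_3]=[x_2,x_4]=x_6$, and in which the metric restricted to $L$ has matrix $$\langle\,,\rangle_0=\begin{pmatrix} 0&0&0&0&a&1 \\ 0&0&b&c&0&0 \\ 0&b&0&0&0&0 \\ 0&c&0&d&0&0 \\ a&0&0&0&\frac{1}{3d}&0 \\ 1&0&0&0&0&0 \end{pmatrix}$$ for some $a,c\in\mathbb{R}$, $b\in\mathbb{R}\setminus\{0\}$ and $d>0$.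
   Context: All Lie algebras are real and finite-dimensional. A pseudo-Euclidean metric on a Lie algebra $\mathfrak{g}$ is a non-degenerate symmetric bilinear form $\langle\,,\rangle$. Its Levi-Civita product $(u,v)\mapsto u.v$ is defined by $2\langle u.v,w\rangle=\langle[u,v],w\rangle+\langle[w,u],v\rangle+\langle[w,v],u\rangle$. With $\mathrm{L}_u v=u.v$, the metric is flat if $\mathrm{L}_{[u,v]}=[\mathrm{L}_u,\mathrm{L}_v]$ for all $u,v$. Signature $(p,q)$ means $p$ negative and $q$ positive directions. A 2-step nilpotent Lie algebra is a non-abelian Lie algebra with $[\mathfrak{g},\mathfrak{g}]\subset Z(\mathfrak{g})$, where $Z(\mathfrak{g})$ is the center; $\perp$ is the orthogonal for the metric. $\mathcal{H}_3$ is the 3-dimensional Heisenberg Lie algebra. $\mathrm{L}_6^4$ is the 6-dimensional Lie algebra with basis $\{x_1,\dots,x_6\}$ and only non-vanishing brackets $[x_1,x_2]=x_5$, $[x_1,x_3]=[x_2,x_4]=x_6$. A Lie algebra is a trivial extension of $\mathfrak{k}$ if it is isomorphic to the direct sum of Lie algebras $\mathbb{R}^m\oplus\mathfrak{k}$ with $\mathbb{R}^m$ abelian, $m\ge 0$. *)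

theory Defs
  imports "HOL-Analysis.Analysis" "HOL-Analysis.Finite_Function_Topology"
begin

text \<open>A real finite-dimensional Lie algebra is a bracket on a type of class
  \<open>euclidean_space\<close>. The class only supplies finite dimension: its inner product
  and norm play no role below.\<close>

definition lie_algebra :: "('a::euclidean_space \<Rightarrow> 'a \<Rightarrow> 'a) \<Rightarrow> bool" where
  "lie_algebra br \<longleftrightarrow> bilinear br \<and> (\<forall>x. br x x = 0) \<and>
     (\<forall>x y z. br x (br y z) + br y (br z x) + br z (br x y) = 0)"

definition lie_center :: "('a::euclidean_space \<Rightarrow> 'a \<Rightarrow> 'a) \<Rightarrow> 'a set" where
  "lie_center br = {z. \<forall>x. br z x = 0}"

definition derived_algebra :: "('a::euclidean_space \<Rightarrow> 'a \<Rightarrow> 'a) \<Rightarrow> 'a set" where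
  "derived_algebra br = span {br x y | x y. True}"

definition two_step_nilpotent :: "('a::euclidean_space \<Rightarrow> 'a \<Rightarrow> 'a) \<Rightarrow> bool" where
  "two_step_nilpotent br \<longleftrightarrow>
     (\<exists>x y. br x y \<noteq> 0) \<and> derived_algebra br \<subseteq> lie_center br"

definition lie_subalgebra :: "('a::euclidean_space \<Rightarrow> 'a \<Rightarrow> 'a) \<Rightarrow> 'a set \<Rightarrow> bool" where
  "lie_subalgebra br L \<longleftrightarrow> subspace L \<and> (\<forall>x\<in>L. \<forall>y\<in>L. br x y \<in> L)"


definition pseudo_euclidean_metric :: "('a::euclidean_space \<Rightarrow> 'a \<Rightarrow> real) \<Rightarrow> bool" where
  "pseudo_euclidean_metric B \<longleftrightarrow> bilinear B \<and> (\<forall>x y. B x y = B y x) \<and>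
     (\<forall>x. (\<forall>y. B x y = 0) \<longrightarrow> x = 0)"

definition metric_orthogonal :: "('a::euclidean_space \<Rightarrow> 'a \<Rightarrow> real) \<Rightarrow> 'a set \<Rightarrow> 'a set" where
  "metric_orthogonal B S = {x. \<forall>y\<in>S. B x y = 0}"

text \<open>Signature with \<open>p\<close> negative and \<open>q\<close> positive directions.\<close>

definition has_signature :: "('a::euclidean_space \<Rightarrow> 'a \<Rightarrow> real) \<Rightarrow> nat \<Rightarrow> nat \<Rightarrow> bool" where
  "has_signature B p q \<longleftrightarrow> (\<exists>N P. finite N \<and> finite P \<and> N \<inter> P = {} \<and>
     independent (N \<union> P) \<and> span (N \<union> P) = UNIV \<and>
     pairwise (\<lambda>x y. B x y = 0) (N \<union> P) \<and>
     card N = p \<and> (\<forall>x\<in>N. B x x < 0) \<and>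
     card P = q \<and> (\<forall>x\<in>P. B x x > 0))"

text \<open>The described vector exists and is unique when \<open>br\<close> is bilinear and \<open>B\<close> is
  bilinear, symmetric and non-degenerate; otherwise the value may be unspecified.\<close>

definition levi_civita ::
  "('a::euclidean_space \<Rightarrow> 'a \<Rightarrow> 'a) \<Rightarrow> ('a \<Rightarrow> 'a \<Rightarrow> real) \<Rightarrow> 'a \<Rightarrow> 'a \<Rightarrow> 'a" where
  "levi_civita br B u v =
     (THE z. \<forall>w. 2 * B z w = B (br u v) w + B (br w u) v + B (br w v) u)"

definition flat_metric ::
  "('a::euclidean_space \<Rightarrow> 'a \<Rightarrow> 'a) \<Rightarrow> ('a \<Rightarrow> 'a \<Rightarrow> real) \<Rightarrow> bool" where
  "flat_metric br B \<longleftrightarrow> (\<forall>u v w.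
     levi_civita br B (br u v) w =
       levi_civita br B u (levi_civita br B v w) - levi_civita br B v (levi_civita br B u w))"


text \<open>Since \<open>m\<close> ranges over all naturals, including \<open>0\<close>, the space \<open>\<real>\<^sup>m\<close> is taken as a
  subspace of the finitely supported sequences rather than as a type.\<close>

definition R_space :: "nat \<Rightarrow> (nat \<Rightarrow>\<^sub>0 real) set" where
  "R_space m = {v. Poly_Mapping.keys v \<subseteq> {..<m}}"

text \<open>A linear map between the subspaces \<open>V\<close> and \<open>W\<close> is given as the restriction of a
  linear map between the ambient spaces; every linear map on \<open>V\<close> extends.\<close>

definition lie_isomorphic ::
  "'a::real_vector set \<Rightarrow> ('a \<Rightarrow> 'a \<Rightarrow> 'a) \<Rightarrow> 'b::real_vector set \<Rightarrow> ('b \<Rightarrow> 'b \<Rightarrow> 'b) \<Rightarrow> bool" where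
  "lie_isomorphic V br W br' \<longleftrightarrow> (\<exists>f. linear f \<and> bij_betw f V W \<and>
     (\<forall>x\<in>V. \<forall>y\<in>V. f (br x y) = br' (f x) (f y)))"

definition direct_sum_bracket ::
  "('a \<Rightarrow> 'a \<Rightarrow> 'a) \<Rightarrow> ('b \<Rightarrow> 'b \<Rightarrow> 'b) \<Rightarrow> 'a \<times> 'b \<Rightarrow> 'a \<times> 'b \<Rightarrow> 'a \<times> 'b" where
  "direct_sum_bracket br br' = (\<lambda>(x, y) (x', y'). (br x x', br' y y'))"

text \<open>\<open>trivial_extension br k\<close>: the Lie algebra \<open>br\<close> is a trivial extension of \<open>k\<close>.\<close>

definition trivial_extension ::
  "('a::euclidean_space \<Rightarrow> 'a \<Rightarrow> 'a) \<Rightarrow> ('k::euclidean_space \<Rightarrow> 'k \<Rightarrow> 'k) \<Rightarrow> bool" where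
  "trivial_extension br k \<longleftrightarrow> (\<exists>m. lie_isomorphic
     (UNIV :: 'a set) br (R_space m \<times> (UNIV :: 'k set)) (direct_sum_bracket (\<lambda>_ _. 0) k))"


text \<open>The index types \<open>3\<close> and \<open>6\<close> are the integers modulo 3 and 6, so the numerals
  \<open>1, \<dots>, 6\<close> denote the six distinct elements of type \<open>6\<close>.\<close>

definition H3_bracket :: "real^3 \<Rightarrow> real^3 \<Rightarrow> real^3" where
  "H3_bracket u v = (u$1 * v$2 - u$2 * v$1) *\<^sub>R axis 3 1"

definition L64_bracket :: "real^6 \<Rightarrow> real^6 \<Rightarrow> real^6" where
  "L64_bracket u v = (u$1 * v$2 - u$2 * v$1) *\<^sub>R axis 5 1 +
     (u$1 * v$3 - u$3 * v$1 + u$2 * v$4 - u$4 * v$2) *\<^sub>R axis 6 1"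

definition L64_basis ::
  "('a::euclidean_space \<Rightarrow> 'a \<Rightarrow> 'a) \<Rightarrow> 'a set \<Rightarrow> (6 \<Rightarrow> 'a) \<Rightarrow> bool" where
  "L64_basis br L x \<longleftrightarrow> inj x \<and> independent (range x) \<and> span (range x) = L \<and>
     br (x 1) (x 2) = x 5 \<and> br (x 1) (x 3) = x 6 \<and> br (x 2) (x 4) = x 6 \<and>
     (\<forall>i j. (i, j) \<notin> {(1, 2), (2, 1), (1, 3), (3, 1), (2, 4), (4, 2)} \<longrightarrow> br (x i) (x j) = 0)"

definition metric0 :: "real \<Rightarrow> real \<Rightarrow> real \<Rightarrow> real \<Rightarrow> real^6^6" where
  "metric0 a b c d = vector
    [vector [0, 0, 0, 0, a,           1],
     vector [0, 0, b, c, 0,           0],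
     vector [0, b, 0, 0, 0,           0],
     vector [0, c, 0, d, 0,           0],
     vector [a, 0, 0, 0, 1 / (3 * d), 0],
     vector [1, 0, 0, 0, 0,           0]]"

end

theory Submission
  imports Defs
begin

text \<open>Write \<open>Z\<close> for the center, let \<open>e\<close> span \<open>Z \<inter> Z\<^sup>\<bottom>\<close>, and for a vector \<open>z\<close> let \<open>J z\<close> be
  the skew endomorphism that represents the 2-form \<open>\<langle>[v, w], z\<rangle>\<close>. Twice the Levi-Civita
  product is \<open>Q u v = [u, v] - J v u - J u v\<close>. Left multiplications are skew and brackets are
  central, so flatness is equivalent to an identity that is quadratic in \<open>Q\<close>,
  \<open>2 \<langle>[x, w], [u, v]\<rangle> = \<langle>Q u w, Q v x\<rangle> - \<langle>Q v w, Q u x\<rangle>\<close> (\<open>flat_eq\<close>), and the whole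
  classification comes from evaluating it at well chosen vectors and using that a metric of
  index two has no totally isotropic subspace of dimension three.

  For central \<open>u\<close> and \<open>w\<close> the identity says that the images of all \<open>J z\<close> with \<open>z \<in> Z\<close> are
  isotropic and orthogonal to each other; they are also orthogonal to \<open>e\<close>. There are two cases.

  If all these \<open>J z\<close> vanish, brackets lie in the line of \<open>e\<close>, so \<open>[v, w] = \<omega>(v, w) e\<close>. Flatness
  makes the image of \<open>e\<^sup>\<bottom>\<close> under the dual of \<open>\<omega>\<close> totally isotropic, and the index bound squeezes it
  into the line of \<open>e\<close>. Hence \<open>\<omega>\<close> vanishes on \<open>e\<^sup>\<bottom>\<close> and has rank two: a trivial extension of the
  Heisenberg algebra (\<open>degenerate_derived_algebra\<close>).

  Otherwise some \<open>J z\<close> takes a value \<open>f\<close> outside the line of \<open>e\<close>, and the isotropic plane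
  \<open>I = span {e, f}\<close> contains all these images. For central \<open>z\<close> the 2-forms \<open>\<langle>[v, w], z\<rangle>\<close> are then all multiples of one
  decomposable form \<open>ab\<close>, and \<open>[v, w] = ab(v, w) c + om(v, w) e\<close> with \<open>\<langle>c, c\<rangle> > 0\<close>. In a frame
  \<open>e', f'\<close> dual to \<open>e, f\<close> flatness gives three facts about \<open>om\<close> and its dual \<open>j\<close>:
  \<open>om(f, x)\<close> is a non-zero multiple of \<open>\<langle>e, x\<rangle>\<close> (\<open>om_f\<close>), \<open>j\<close> maps \<open>I\<^sup>\<bottom>\<close> to \<open>I\<close> (\<open>j_plane\<close>), and
  \<open>\<langle>j f', j f'\<rangle> = 3 \<langle>c, c\<rangle>\<close> (\<open>j_norm\<close>), which is where the entry \<open>1 / (3 d)\<close> comes from.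
  They say that \<open>e', f', f, j f', c, e\<close> are up to scaling the six basis vectors of the second
  algebra and that the remaining directions can be chosen central; adjusting \<open>e'\<close> and \<open>f'\<close> along the
  other vectors puts the metric into the stated shape (\<open>normal_form\<close>).

  Conversely both model algebras carry explicit flat metrics, and a Euclidean metric on the abelian
  factor extends them without changing the number of negative directions or the radical
  (\<open>admissible_metric_central_extension\<close>).\<close>

section \<open>Coordinates indexed by six elements\<close>

lemma exhaust_6: fixes x::6 shows "x = 1 \<or> x = 2 \<or> x = 3 \<or> x = 4 \<or> x = 5 \<or> x = (6::6)"
proof (induct x)
  case (of_int z)
  then have "z = 0 \<or> z = 1 \<or> z = 2 \<or> z = 3 \<or> z = 4 \<or> z = 5" by simp arith
  then show ?case by (elim disjE) simp_all
qed

lemma forall_6: "(\<forall>i::6. P i) \<longleftrightarrow> P 1 \<and> P 2 \<and> P 3 \<and> P 4 \<and> P 5 \<and> P 6"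
proof (intro iffI allI)
  fix i :: 6 assume "P 1 \<and> P 2 \<and> P 3 \<and> P 4 \<and> P 5 \<and> P 6"
  then show "P i" using exhaust_6[of i] by (elim disjE) simp_all
qed simp

lemma UNIV_6: "UNIV = {1::6, 2, 3, 4, 5, 6}"
  by (rule set_eqI) (use exhaust_6 in simp)

lemma sum_6: "sum f (UNIV::6 set) = f 1 + f 2 + f 3 + f 4 + f 5 + f 6"
  unfolding UNIV_6 by (simp add: add.assoc)

lemma vector_6 [simp]:
  "(vector [a,b,c,d,e,f] :: 'a::zero^6) $ 1 = a"
  "(vector [a,b,c,d,e,f] :: 'a::zero^6) $ 2 = b"
  "(vector [a,b,c,d,e,f] :: 'a::zero^6) $ 3 = c"
  "(vector [a,b,c,d,e,f] :: 'a::zero^6) $ 4 = d"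
  "(vector [a,b,c,d,e,f] :: 'a::zero^6) $ 5 = e"
  "(vector [a,b,c,d,e,f] :: 'a::zero^6) $ 6 = f"
  unfolding vector_def by simp_all

section \<open>Trivial extensions as central splittings\<close>

text \<open>A trivial extension seen from inside: the abelian factor is a central subspace instead of an
  abstract \<open>\<real>\<^sup>m\<close>, so no coordinates on it have to be chosen.\<close>

definition central_splitting ::
  "('a::euclidean_space \<Rightarrow> 'a \<Rightarrow> 'a) \<Rightarrow> ('k::euclidean_space \<Rightarrow> 'k \<Rightarrow> 'k) \<Rightarrow> ('k \<Rightarrow> 'a) \<Rightarrow> 'a set \<Rightarrow> bool" where
  "central_splitting br k \<phi> Z1 \<longleftrightarrow> linear \<phi> \<and> inj \<phi> \<and> (\<forall>u v. br (\<phi> u) (\<phi> v) = \<phi> (k u v)) \<and>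
     subspace Z1 \<and> Z1 \<subseteq> lie_center br \<and> Z1 \<inter> range \<phi> = {0} \<and> (\<forall>v. \<exists>l. v - \<phi> l \<in> Z1)"

lemma central_splittingI:
  assumes lin: "linear \<phi>" and hom: "\<And>u v. br (\<phi> u) (\<phi> v) = \<phi> (k u v)"
    and Z1: "subspace Z1" "Z1 \<subseteq> lie_center br"
    and ker: "\<And>l. \<phi> l \<in> Z1 \<Longrightarrow> l = 0" and ex: "\<And>v. \<exists>l. v - \<phi> l \<in> Z1"
  shows "central_splitting br k \<phi> Z1"
proof -
  have "inj \<phi>" unfolding linear_injective_0[OF lin] using ker subspace_0[OF Z1(1)] by metis
  moreover have "Z1 \<inter> range \<phi> = {0}"
  proof -
    have "0 \<in> range \<phi>" using linear_0[OF lin] by (metis rangeI)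
    moreover have "\<phi> l = 0" if "\<phi> l \<in> Z1" for l using ker[OF that] linear_0[OF lin] by simp
    ultimately show ?thesis using subspace_0[OF Z1(1)] by blast
  qed
  ultimately show ?thesis unfolding central_splitting_def using assms by blast
qed

text \<open>The coordinate along the image of \<open>\<phi>\<close> is linear because it is unique.\<close>

lemma complement_projection:
  fixes \<phi> :: "'k::real_vector \<Rightarrow> 'a::real_vector"
  assumes lin: "linear \<phi>" and inj: "inj \<phi>" and sub: "subspace Z1"
    and disj: "Z1 \<inter> range \<phi> = {0}" and ex: "\<forall>v. \<exists>l. v - \<phi> l \<in> Z1"
  obtains \<psi> where "linear \<psi>" "\<And>v. v - \<phi> (\<psi> v) \<in> Z1" "\<And>l. \<psi> (\<phi> l) = l" "\<And>z. z \<in> Z1 \<Longrightarrow> \<psi> z = 0"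
proof -
  obtain \<psi> where \<psi>: "\<And>v. v - \<phi> (\<psi> v) \<in> Z1" using ex by metis
  have uniq: "\<psi> v = l" if "v - \<phi> l \<in> Z1" for v l
  proof -
    have "(v - \<phi> l) - (v - \<phi> (\<psi> v)) \<in> Z1" using \<psi> sub that subspace_diff by blast
    then have "\<phi> (\<psi> v - l) \<in> Z1" by (simp add: linear_diff[OF lin])
    then have "\<phi> (\<psi> v - l) \<in> Z1 \<inter> range \<phi>" by blast
    then have "\<phi> (\<psi> v - l) = \<phi> 0" using disj by (simp add: linear_0[OF lin])
    then show ?thesis using inj by (simp add: inj_eq)
  qed
  show thesis
  proof
    show "linear \<psi>"
    proof (rule linearI)
      fix u v show "\<psi> (u + v) = \<psi> u + \<psi> v"
        using subspace_add[OF sub \<psi> \<psi>, of u v]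
        by (intro uniq) (simp add: linear_add[OF lin] algebra_simps)
    next
      fix r v show "\<psi> (r *\<^sub>R v) = r *\<^sub>R \<psi> v"
        using subspace_scale[OF sub \<psi>, of r v]
        by (intro uniq) (simp add: linear_cmul[OF lin] algebra_simps)
    qed
    show "\<psi> (\<phi> l) = l" for l by (rule uniq) (simp add: subspace_0[OF sub])
    show "\<psi> z = 0" if "z \<in> Z1" for z by (rule uniq) (simp add: linear_0[OF lin] that)
  qed (rule \<psi>)
qed

lemma lookup_scaleR: "Poly_Mapping.lookup (c *\<^sub>R p) i = c *\<^sub>R Poly_Mapping.lookup p i"
proof -
  have "{i. c *\<^sub>R Poly_Mapping.lookup p i \<noteq> 0} \<subseteq> Poly_Mapping.keys p" by (auto simp: in_keys_iff)
  then have "finite {i. c *\<^sub>R Poly_Mapping.lookup p i \<noteq> 0}" using finite_keys finite_subset by blast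
  then show ?thesis by (simp add: scaleR_poly_mapping_def)
qed

lemma subspace_R_space: "subspace (R_space m)"
proof -
  have "Poly_Mapping.keys (u + v) \<subseteq> Poly_Mapping.keys u \<union> Poly_Mapping.keys v" for u v :: "nat \<Rightarrow>\<^sub>0 real"
    by (rule keys_add)
  moreover have "Poly_Mapping.keys (c *\<^sub>R v) \<subseteq> Poly_Mapping.keys v" for c and v :: "nat \<Rightarrow>\<^sub>0 real"
    by (auto simp: in_keys_iff lookup_scaleR)
  ultimately show ?thesis unfolding R_space_def subspace_def
    by simp (meson Un_least order_trans)
qed

lemma R_space_coordinates:
  assumes sub: "subspace Z1"
  obtains m and g :: "(nat \<Rightarrow>\<^sub>0 real) \<Rightarrow> 'a::euclidean_space"
  where "linear g" "inj_on g (R_space m)" "g ` R_space m = Z1"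
proof -
  obtain C where C: "C \<subseteq> Z1" "independent C" "Z1 \<subseteq> span C" "card C = dim Z1"
    using basis_exists by blast
  have finC: "finite C" using C(2) independent_imp_finite by blast
  obtain b where b: "bij_betw b {..<card C} C"
    using finC ex_bij_betw_nat_finite[of C] by (auto simp: atLeast0LessThan)
  define g where "g p = (\<Sum>i<card C. Poly_Mapping.lookup p i *\<^sub>R b i)" for p :: "nat \<Rightarrow>\<^sub>0 real"
  have lin: "linear g"
    by (rule linearI) (simp_all add: g_def lookup_add sum.distrib scaleR_left_distrib scaleR_right.sum lookup_scaleR)
  have img: "b i \<in> C" if "i < card C" for i using b that by (auto simp: bij_betw_def)
  have inj: "inj_on g (R_space (card C))"
  proof (subst linear_inj_on_iff_eq_0[OF lin subspace_R_space], intro ballI impI)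
    fix p assume p: "p \<in> R_space (card C)" and "g p = 0"
    then have "(\<Sum>x\<in>C. Poly_Mapping.lookup p (the_inv_into {..<card C} b x) *\<^sub>R x) = 0"
      unfolding g_def using b
      by (subst sum.reindex_bij_betw[OF b, symmetric])
        (simp add: the_inv_into_f_f bij_betw_def)
    then have "\<forall>x\<in>C. Poly_Mapping.lookup p (the_inv_into {..<card C} b x) = 0"
      using independentD[OF C(2) finC order_refl, of "\<lambda>x. Poly_Mapping.lookup p (the_inv_into {..<card C} b x)"]
      by simp
    then have "Poly_Mapping.lookup p i = 0" if "i < card C" for i
      using img[OF that] b that by (metis bij_betw_def lessThan_iff the_inv_into_f_f)
    moreover have "Poly_Mapping.lookup p i = 0" if "\<not> i < card C" for i
      using p that unfolding R_space_def by (auto simp: in_keys_iff)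
    ultimately show "p = 0" by (intro poly_mapping_eqI) auto
  qed
  have "g ` R_space (card C) = Z1"
  proof (intro equalityI subsetI)
    fix v assume "v \<in> g ` R_space (card C)"
    then show "v \<in> Z1" unfolding g_def using img C(1) sub
      by (auto intro!: subspace_sum subspace_scale)
  next
    fix v assume "v \<in> Z1"
    then obtain r where r: "v = (\<Sum>x\<in>C. r x *\<^sub>R x)"
      using C(3) span_finite[OF finC] by auto
    define p where "p = (\<Sum>i<card C. Poly_Mapping.single i (r (b i)))"
    have lk: "Poly_Mapping.lookup p i = (if i < card C then r (b i) else 0)" for i
      unfolding p_def by (simp add: lookup_sum lookup_single when_def)
    have "p \<in> R_space (card C)" unfolding R_space_def by (auto simp: in_keys_iff lk split: if_splits)
    moreover have "g p = v" unfolding g_def r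
      by (subst sum.reindex_bij_betw[OF b, symmetric]) (simp add: lk)
    ultimately show "v \<in> g ` R_space (card C)" by blast
  qed
  with lin inj show thesis by (rule that)
qed

lemma lie_center_bracket:
  assumes "lie_algebra br" "z \<in> lie_center br"
  shows "br z x = 0" "br x z = 0"
proof -
  have bl: "bilinear br" and al: "\<And>x. br x x = 0" using assms(1) by (auto simp: lie_algebra_def)
  show z: "br z x = 0" for x using assms(2) by (auto simp: lie_center_def)
  have "br (x + z) (x + z) = br x x + br x z + (br z x + br z z)"
    by (simp only: bilinear_ladd[OF bl] bilinear_radd[OF bl]) (simp add: algebra_simps)
  then show "br x z = 0" by (simp add: al z)
qed

text \<open>From an isomorphism \<open>f\<close> one reads off \<open>\<phi>\<close> as the inverse of \<open>f\<close> on the second factor and \<open>Z1\<close> as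
  the kernel of the second component. In the other direction, coordinates on \<open>Z1\<close> and the projection
  along it give the isomorphism, and brackets only see the second factor because \<open>Z1\<close> is central.\<close>

lemma trivial_extension_iff_central_splitting:
  fixes k :: "'k::euclidean_space \<Rightarrow> 'k \<Rightarrow> 'k"
  assumes la: "lie_algebra br"
  shows "trivial_extension br k \<longleftrightarrow> (\<exists>\<phi> Z1. central_splitting br k \<phi> Z1)"
proof
  assume "trivial_extension br k"
  then obtain m and f :: "'a \<Rightarrow> (nat \<Rightarrow>\<^sub>0 real) \<times> 'k" where f: "linear f" "bij_betw f UNIV (R_space m \<times> UNIV)"
    and hom: "\<And>x y. f (br x y) = direct_sum_bracket (\<lambda>_ _. 0) k (f x) (f y)"
    unfolding trivial_extension_def lie_isomorphic_def by auto
  have inj: "inj f" and rng: "range f = R_space m \<times> UNIV" using f(2) by (auto simp: bij_betw_def)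
  obtain g where g: "linear g" "\<And>v. g (f v) = v"
    using linear_exists_left_inverse_on[OF f(1) subspace_UNIV] inj by auto
  have fg: "f (g y) = y" if "y \<in> R_space m \<times> UNIV" for y using that g(2) unfolding rng[symmetric] by auto
  have zin: "0 \<in> R_space m" using subspace_R_space subspace_0 by blast
  define \<phi> where "\<phi> l = g (0, l)" for l
  define Z1 where "Z1 = {v. snd (f v) = 0}"
  have f\<phi>: "f (\<phi> l) = (0, l)" for l unfolding \<phi>_def using zin by (intro fg) auto
  have lin\<phi>: "linear \<phi>"
    unfolding \<phi>_def using linear_add[OF g(1)] linear_cmul[OF g(1)]
    by (intro linearI) (metis add_Pair add.right_neutral, metis scaleR_Pair scaleR_zero_right)
  have "inj \<phi>" by (rule injI) (metis f\<phi> prod.inject)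
  moreover have "br (\<phi> u) (\<phi> v) = \<phi> (k u v)" for u v
    by (rule injD[OF inj]) (simp add: hom f\<phi> direct_sum_bracket_def)
  moreover have "subspace Z1" unfolding Z1_def subspace_def
    by (simp add: linear_0[OF f(1)] linear_add[OF f(1)] linear_cmul[OF f(1)])
  moreover have "Z1 \<subseteq> lie_center br"
  proof
    fix z assume "z \<in> Z1"
    then have z: "snd (f z) = 0" by (simp add: Z1_def)
    have "br z x = 0" for x
    proof -
      define l where "l = snd (f x)"
      have "f (br z x) = direct_sum_bracket (\<lambda>_ _. 0) k (f 0) (f (\<phi> l))"
        unfolding hom using z
        by (simp add: direct_sum_bracket_def split_beta f\<phi> l_def linear_0[OF f(1)])
      also have "\<dots> = f (br 0 (\<phi> l))" by (simp add: hom)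
      finally have "br z x = br 0 (\<phi> l)" using inj by (simp add: inj_eq)
      then show ?thesis using la by (simp add: lie_algebra_def bilinear_lzero)
    qed
    then show "z \<in> lie_center br" by (simp add: lie_center_def)
  qed
  moreover have "Z1 \<inter> range \<phi> = {0}"
  proof -
    have "snd (f 0) = 0" by (simp add: linear_0[OF f(1)])
    moreover have "0 \<in> range \<phi>" by (metis linear_0[OF lin\<phi>] rangeI)
    ultimately show ?thesis by (auto simp: Z1_def f\<phi> linear_0[OF lin\<phi>])
  qed
  moreover have "v - \<phi> (snd (f v)) \<in> Z1" for v
    by (simp add: Z1_def linear_diff[OF f(1)] f\<phi>)
  ultimately show "\<exists>\<phi> Z1. central_splitting br k \<phi> Z1"
    using lin\<phi> unfolding central_splitting_def by blast
next
  assume "\<exists>\<phi> Z1. central_splitting br k \<phi> Z1"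
  then obtain \<phi> Z1 where cs: "linear \<phi>" "inj \<phi>" "\<And>u v. br (\<phi> u) (\<phi> v) = \<phi> (k u v)"
     "subspace Z1" "Z1 \<subseteq> lie_center br" "Z1 \<inter> range \<phi> = {0}" "\<forall>v. \<exists>l. v - \<phi> l \<in> Z1"
    unfolding central_splitting_def by blast
  obtain \<psi> where \<psi>: "linear \<psi>" "\<And>v. v - \<phi> (\<psi> v) \<in> Z1" "\<And>l. \<psi> (\<phi> l) = l" "\<And>z. z \<in> Z1 \<Longrightarrow> \<psi> z = 0"
    using complement_projection cs by metis
  obtain m and g :: "(nat \<Rightarrow>\<^sub>0 real) \<Rightarrow> 'a" where
    g: "linear g" "inj_on g (R_space m)" "g ` R_space m = Z1"
    using R_space_coordinates[OF cs(4)] by blast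
  obtain h where h: "linear h" "\<And>p. p \<in> R_space m \<Longrightarrow> h (g p) = p" "range h \<subseteq> R_space m"
    using linear_exists_left_inverse_on[OF g(1) subspace_R_space g(2)] by auto
  have gh: "g (h z) = z" if "z \<in> Z1" for z using that h(2) unfolding g(3)[symmetric] by auto
  define f where "f v = (h (v - \<phi> (\<psi> v)), \<psi> v)" for v
  have "linear f" unfolding f_def
    by (rule linearI)
      (simp_all add: linear_add[OF \<psi>(1)] linear_add[OF cs(1)] linear_add[OF h(1)] linear_diff[OF h(1)]
        linear_cmul[OF \<psi>(1)] linear_cmul[OF cs(1)] linear_cmul[OF h(1)] algebra_simps)
  moreover have "bij_betw f UNIV (R_space m \<times> UNIV)"
  proof (rule bij_betw_byWitness[where f' = "\<lambda>(p, l). g p + \<phi> l"])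
    show "\<forall>a\<in>UNIV. (case f a of (p, l) \<Rightarrow> g p + \<phi> l) = a"
      by (simp add: f_def gh[OF \<psi>(2)])
    show "\<forall>a'\<in>R_space m \<times> UNIV. f (case a' of (p, l) \<Rightarrow> g p + \<phi> l) = a'"
    proof (clarsimp simp: f_def)
      fix p and l :: 'k assume p: "p \<in> R_space m"
      then have "g p \<in> Z1" using g(3) by auto
      then have "\<psi> (g p + \<phi> l) = l" by (simp add: linear_add[OF \<psi>(1)] \<psi>)
      then show "h (g p + \<phi> l - \<phi> (\<psi> (g p + \<phi> l))) = p \<and> \<psi> (g p + \<phi> l) = l" by (simp add: h(2)[OF p])
    qed
    show "f ` UNIV \<subseteq> R_space m \<times> UNIV" using h(3) by (auto simp: f_def)
  qed simp
  moreover have "f (br x y) = direct_sum_bracket (\<lambda>_ _. 0) k (f x) (f y)" for x y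
  proof -
    have bl: "bilinear br" using la by (simp add: lie_algebra_def)
    have "x - \<phi> (\<psi> x) \<in> lie_center br" "y - \<phi> (\<psi> y) \<in> lie_center br" using \<psi>(2) cs(5) by auto
    then have "br x y = br (\<phi> (\<psi> x)) (\<phi> (\<psi> y))"
      using lie_center_bracket[OF la]
      by (metis (no_types, opaque_lifting) bilinear_lsub[OF bl] bilinear_rsub[OF bl] eq_iff_diff_eq_0)
    then show ?thesis
      by (simp add: cs(3) f_def direct_sum_bracket_def \<psi>(3) linear_0[OF h(1)])
  qed
  ultimately show "trivial_extension br k"
    unfolding trivial_extension_def lie_isomorphic_def by blast
qed

section \<open>Orthogonal bases and the Levi-Civita product\<close>

lemma bilinear_real_sum_left:
  assumes "bilinear B" shows "B (\<Sum>v\<in>S. c v *\<^sub>R v) w = (\<Sum>v\<in>S. c v * (B v w :: real))"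
proof -
  have "linear (\<lambda>x. B x w)" using assms by (simp add: bilinear_def)
  from linear_sum[OF this, of "\<lambda>v. c v *\<^sub>R v" S] show ?thesis
    by (simp add: bilinear_lmul[OF assms])
qed

lemma orthogonal_nonisotropic_independent:
  assumes B: "bilinear B" and fin: "finite S"
    and orth: "pairwise (\<lambda>x y. B x y = (0::real)) S" and nz: "\<And>x. x \<in> S \<Longrightarrow> B x x \<noteq> 0"
  shows "independent S"
proof
  assume "dependent S"
  then obtain c w where w: "w \<in> S" "c w \<noteq> 0" and s: "(\<Sum>v\<in>S. c v *\<^sub>R v) = 0"
    using dependent_finite[OF fin] by auto
  have "(\<Sum>v\<in>S. c v * B v w) = 0"
    using bilinear_real_sum_left[OF B, of c S w] s by (simp add: bilinear_lzero[OF B])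
  moreover have "(\<Sum>v\<in>S. c v * B v w) = c w * B w w"
    using orth w by (subst sum.remove[OF fin w(1)]) (auto simp: pairwise_def intro!: sum.neutral)
  ultimately show False using w nz by simp
qed

text \<open>For orthogonal vectors of non-zero square, independence is automatic, and then spanning is a matter
  of counting.\<close>

lemma has_signatureI:
  fixes B :: "'a::euclidean_space \<Rightarrow> 'a \<Rightarrow> real"
  assumes B: "bilinear B" and fin: "finite N" "finite P"
    and orth: "pairwise (\<lambda>x y. B x y = 0) (N \<union> P)"
    and neg: "\<And>x. x \<in> N \<Longrightarrow> B x x < 0" and pos: "\<And>x. x \<in> P \<Longrightarrow> B x x > 0"
    and card: "card N = p" "card P = q" and dim: "p + q = DIM('a)"
  shows "has_signature B p q"
proof -
  have disj: "N \<inter> P = {}" using neg pos by fastforce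
  have ind: "independent (N \<union> P)"
    by (rule orthogonal_nonisotropic_independent[OF B _ orth]) (use fin neg pos in force)+
  have "card (N \<union> P) = DIM('a)" using card dim disj fin by (simp add: card_Un_disjoint)
  then have "UNIV \<subseteq> span (N \<union> P)"
    by (intro card_ge_dim_independent ind) simp_all
  then have "span (N \<union> P) = UNIV" by blast
  then show ?thesis unfolding has_signature_def using assms disj ind by blast
qed

lemma pseudo_euclidean_metric_eqI:
  assumes "pseudo_euclidean_metric B" "\<And>w. B x w = B y w" shows "x = y"
proof -
  have "bilinear B" using assms(1) by (simp add: pseudo_euclidean_metric_def)
  then have "B (x - y) w = 0" for w by (simp add: bilinear_lsub assms(2))
  then show ?thesis using assms(1) unfolding pseudo_euclidean_metric_def by (metis eq_iff_diff_eq_0)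
qed

lemma pseudo_euclidean_metric_represents:
  fixes B :: "'a::euclidean_space \<Rightarrow> 'a \<Rightarrow> real"
  assumes pm: "pseudo_euclidean_metric B" and lin: "linear \<alpha>"
  obtains z where "\<And>w. B z w = \<alpha> w"
proof -
  have B: "bilinear B" using pm by (simp add: pseudo_euclidean_metric_def)
  have linB: "linear (B z)" for z using B by (auto simp: bilinear_def)
  define T where "T z = (\<Sum>b\<in>Basis. B z b *\<^sub>R b)" for z
  have Tb: "T z \<bullet> b = B z b" if "b \<in> Basis" for z b
    unfolding T_def using that by simp
  have linT: "linear T"
    by (rule linearI) (simp_all add: T_def bilinear_ladd[OF B] bilinear_lmul[OF B]
        scaleR_left_distrib sum.distrib scaleR_right.sum)
  have "inj T"
  proof (rule injI)
    fix x y assume "T x = T y"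
    then have "\<And>b. b \<in> Basis \<Longrightarrow> B x b = B y b" using Tb by metis
    then have "B x = B y" using linear_eq_stdbasis[OF linB linB] by blast
    then show "x = y" using pseudo_euclidean_metric_eqI[OF pm] by simp
  qed
  then have "surj T" using linear_injective_imp_surjective[OF linT] by blast
  then obtain z where "(\<Sum>b\<in>Basis. \<alpha> b *\<^sub>R b) = T z" by (meson surjD)
  then have "\<alpha> b = B z b" if "b \<in> Basis" for b
    using Tb[OF that, of z] that by (metis inner_sum_left_Basis)
  then have "B z = \<alpha>" using linear_eq_stdbasis[OF linB lin, of z] by metis
  then show thesis using that[of z] by simp
qed

lemma levi_civita_eqI:
  assumes pm: "pseudo_euclidean_metric B"
    and "\<And>w. 2 * B z w = B (br u v) w + B (br w u) v + B (br w v) u"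
  shows "levi_civita br B u v = z"
  unfolding levi_civita_def
proof (rule the_equality)
  fix y assume "\<forall>w. 2 * B y w = B (br u v) w + B (br w u) v + B (br w v) u"
  then have "2 * B y w = 2 * B z w" for w using assms(2)[of w] by metis
  then show "y = z" using pseudo_euclidean_metric_eqI[OF pm] by simp
qed (use assms in simp)

lemma levi_civita_koszul:
  assumes pm: "pseudo_euclidean_metric B" and br: "bilinear br"
  shows "2 * B (levi_civita br B u v) w = B (br u v) w + B (br w u) v + B (br w v) u"
proof -
  have B: "bilinear B" using pm by (simp add: pseudo_euclidean_metric_def)
  have "linear (\<lambda>w. (B (br u v) w + B (br w u) v + B (br w v) u) / 2)"
  proof (rule linearI)
    fix x y
    have "B (br u v) (x + y) + B (br (x + y) u) v + B (br (x + y) v) u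
      = (B (br u v) x + B (br x u) v + B (br x v) u) + (B (br u v) y + B (br y u) v + B (br y v) u)"
      by (simp only: bilinear_ladd[OF B] bilinear_radd[OF B] bilinear_ladd[OF br] ac_simps)
    then show "(B (br u v) (x + y) + B (br (x + y) u) v + B (br (x + y) v) u) / 2
      = (B (br u v) x + B (br x u) v + B (br x v) u) / 2 + (B (br u v) y + B (br y u) v + B (br y v) u) / 2"
      by (simp only: add_divide_distrib)
  next
    fix c x
    show "(B (br u v) (c *\<^sub>R x) + B (br (c *\<^sub>R x) u) v + B (br (c *\<^sub>R x) v) u) / 2
      = c *\<^sub>R ((B (br u v) x + B (br x u) v + B (br x v) u) / 2)"
      by (simp only: bilinear_lmul[OF B] bilinear_rmul[OF B] bilinear_lmul[OF br] real_scaleR_def)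
        (simp add: distrib_left)
  qed
  then obtain z where z: "\<And>w. B z w = (B (br u v) w + B (br w u) v + B (br w v) u) / 2"
    using pseudo_euclidean_metric_represents[OF pm] by blast
  have "levi_civita br B u v = z" by (rule levi_civita_eqI[OF pm]) (simp add: z)
  then show ?thesis by (simp add: z)
qed

definition admissible_metric ::
  "('a::euclidean_space \<Rightarrow> 'a \<Rightarrow> 'a) \<Rightarrow> ('a \<Rightarrow> 'a \<Rightarrow> real) \<Rightarrow> bool" where
  "admissible_metric br B \<longleftrightarrow> pseudo_euclidean_metric B \<and> flat_metric br B \<and>
     has_signature B 2 (DIM('a) - 2) \<and> dim (lie_center br \<inter> metric_orthogonal B (lie_center br)) = 1"

section \<open>Flat metrics on trivial extensions\<close>

text \<open>Take the orthogonal sum of \<open>Bk\<close> and the ambient inner product on \<open>Z1\<close>. Since \<open>Z1\<close> is central and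
  orthogonal to the copy of \<open>k\<close>, the Levi-Civita product is that of \<open>k\<close> after projection, so flatness is
  inherited; a definite summand contributes neither negative directions nor vectors orthogonal to the
  center.\<close>

lemma admissible_metric_central_extension:
  fixes br :: "'a::euclidean_space \<Rightarrow> 'a \<Rightarrow> 'a" and k :: "'k::euclidean_space \<Rightarrow> 'k \<Rightarrow> 'k"
  assumes la: "lie_algebra br" and cs: "central_splitting br k \<phi> Z1"
    and blk: "bilinear k" and ad: "admissible_metric k Bk" and dimk: "DIM('k) \<ge> 2"
  shows "\<exists>B. admissible_metric br B"
proof -
  have lin: "linear \<phi>" and inj: "inj \<phi>" and hom: "\<And>u v. br (\<phi> u) (\<phi> v) = \<phi> (k u v)"
    and sub: "subspace Z1" and cen: "Z1 \<subseteq> lie_center br" and disj: "Z1 \<inter> range \<phi> = {0}"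
    and ex: "\<forall>v. \<exists>l. v - \<phi> l \<in> Z1"
    using cs by (auto simp: central_splitting_def)
  have bl: "bilinear br" using la by (simp add: lie_algebra_def)
  have pmk: "pseudo_euclidean_metric Bk" and flk: "flat_metric k Bk"
    and sgk: "has_signature Bk 2 (DIM('k) - 2)"
    and dk: "dim (lie_center k \<inter> metric_orthogonal Bk (lie_center k)) = 1"
    using ad by (auto simp: admissible_metric_def)
  have Bk: "bilinear Bk" and symk: "\<And>x y. Bk x y = Bk y x"
    and ndk: "\<And>x. (\<And>y. Bk x y = 0) \<Longrightarrow> x = 0" using pmk by (auto simp: pseudo_euclidean_metric_def)
  obtain \<psi> where lin\<psi>: "linear \<psi>" and \<psi>: "\<And>v. v - \<phi> (\<psi> v) \<in> Z1" and \<psi>\<phi>: "\<And>l. \<psi> (\<phi> l) = l"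
    and \<psi>Z: "\<And>z. z \<in> Z1 \<Longrightarrow> \<psi> z = 0"
    using complement_projection[OF lin inj sub disj ex] by blast
  define pr where "pr v = v - \<phi> (\<psi> v)" for v
  have linpr: "linear pr" unfolding pr_def
    by (rule linearI) (simp_all add: linear_add[OF lin] linear_add[OF lin\<psi>] linear_cmul[OF lin]
        linear_cmul[OF lin\<psi>] algebra_simps)
  have pr\<phi>: "pr (\<phi> l) = 0" for l by (simp add: pr_def \<psi>\<phi>)
  have prZ: "pr z = z" if "z \<in> Z1" for z by (simp add: pr_def \<psi>Z[OF that] linear_0[OF lin])
  have \<psi>pr: "\<psi> (pr v) = 0" for v using \<psi>Z \<psi> by (simp add: pr_def)
  have prpr: "pr (pr v) = pr v" for v by (rule prZ) (simp add: pr_def \<psi>)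
  define B where "B v w = pr v \<bullet> pr w + Bk (\<psi> v) (\<psi> w)" for v w
  have B: "bilinear B" unfolding bilinear_def
    by (intro conjI allI linearI)
      (simp_all add: B_def linear_add[OF linpr] linear_add[OF lin\<psi>] linear_cmul[OF linpr]
        linear_cmul[OF lin\<psi>] inner_simps bilinear_ladd[OF Bk] bilinear_radd[OF Bk]
        bilinear_lmul[OF Bk] bilinear_rmul[OF Bk] algebra_simps)
  have sym: "B x y = B y x" for x y by (simp add: B_def symk[of "\<psi> x"] inner_commute)
  have B\<phi>: "B v (\<phi> l) = Bk (\<psi> v) l" for v l by (simp add: B_def pr\<phi> \<psi>\<phi>)
  have B\<phi>': "B (\<phi> l) v = Bk l (\<psi> v)" for v l by (simp add: B_def pr\<phi> \<psi>\<phi>)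
  have pm: "pseudo_euclidean_metric B" unfolding pseudo_euclidean_metric_def
  proof (intro conjI allI impI B sym)
    fix x assume 0: "\<forall>y. B x y = 0"
    then have "B x (\<phi> l) = 0" for l by simp
    then have "\<psi> x = 0" using ndk B\<phi> by simp
    moreover have "pr x = 0"
      using 0[rule_format, of "pr x"] by (simp add: B_def prpr \<psi>pr bilinear_rzero[OF Bk])
    ultimately show "x = 0" by (simp add: pr_def linear_0[OF lin])
  qed
  have br: "br u v = \<phi> (k (\<psi> u) (\<psi> v))" for u v
  proof -
    have "pr u \<in> lie_center br" "pr v \<in> lie_center br" using \<psi> cen by (auto simp: pr_def)
    then have "br (pr u + \<phi> (\<psi> u)) (pr v + \<phi> (\<psi> v)) = br (\<phi> (\<psi> u)) (\<phi> (\<psi> v))"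
      by (simp only: bilinear_ladd[OF bl] bilinear_radd[OF bl] lie_center_bracket[OF la] add_0)
    then have "br u v = br (\<phi> (\<psi> u)) (\<phi> (\<psi> v))" by (simp add: pr_def)
    then show ?thesis by (simp add: hom)
  qed
  have lc: "levi_civita br B u v = \<phi> (levi_civita k Bk (\<psi> u) (\<psi> v))" for u v
    by (rule levi_civita_eqI[OF pm])
      (simp only: br B\<phi>' levi_civita_koszul[OF pmk blk])
  have fl: "flat_metric br B"
    using flk unfolding flat_metric_def lc br \<psi>\<phi> by (simp add: linear_diff[OF lin])
  have cn: "lie_center br = {v. \<psi> v \<in> lie_center k}"
  proof -
    have "\<phi> x = 0 \<longleftrightarrow> x = 0" for x using linear_injective_0[OF lin] inj linear_0[OF lin] by auto
    then have "lie_center br = {v. \<forall>x. k (\<psi> v) (\<psi> x) = 0}" by (simp add: lie_center_def br)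
    moreover have "surj \<psi>" using \<psi>\<phi> by (rule surjI)
    then have "(\<forall>x. k (\<psi> v) (\<psi> x) = 0) \<longleftrightarrow> (\<forall>y. k (\<psi> v) y = 0)" for v by (metis surjD)
    ultimately show ?thesis by (simp add: lie_center_def)
  qed
  have "lie_center br \<inter> metric_orthogonal B (lie_center br)
      = \<phi> ` (lie_center k \<inter> metric_orthogonal Bk (lie_center k))"
  proof (intro equalityI subsetI)
    fix v assume v: "v \<in> lie_center br \<inter> metric_orthogonal B (lie_center br)"
    have "pr v \<in> lie_center br" using \<psi> cen by (auto simp: pr_def)
    then have "B v (pr v) = 0" using v by (simp add: metric_orthogonal_def)
    then have "pr v = 0" by (simp add: B_def prpr \<psi>pr bilinear_rzero[OF Bk])
    then have "v = \<phi> (\<psi> v)" by (simp add: pr_def)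
    moreover have "Bk (\<psi> v) y = 0" if "y \<in> lie_center k" for y
    proof -
      have "\<phi> y \<in> lie_center br" using that by (simp add: cn \<psi>\<phi>)
      then have "B v (\<phi> y) = 0" using v by (auto simp: metric_orthogonal_def)
      then show ?thesis by (simp add: B\<phi>)
    qed
    ultimately show "v \<in> \<phi> ` (lie_center k \<inter> metric_orthogonal Bk (lie_center k))"
      using v unfolding cn metric_orthogonal_def by blast
  next
    fix v assume "v \<in> \<phi> ` (lie_center k \<inter> metric_orthogonal Bk (lie_center k))"
    then show "v \<in> lie_center br \<inter> metric_orthogonal B (lie_center br)"
      by (auto simp: cn \<psi>\<phi> metric_orthogonal_def B\<phi>')
  qed
  then have dm: "dim (lie_center br \<inter> metric_orthogonal B (lie_center br)) = 1"
    using dk dim_image_eq[OF lin inj_on_subset[OF inj subset_UNIV]] by simp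
  obtain N P where NP: "finite N" "finite P" "pairwise (\<lambda>x y. Bk x y = 0) (N \<union> P)"
      "card N = 2" "\<forall>x\<in>N. Bk x x < 0" "card P = DIM('k) - 2" "\<forall>x\<in>P. Bk x x > 0"
    using sgk unfolding has_signature_def by (elim exE conjE) (rule that)
  obtain C where C: "C \<subseteq> Z1" "pairwise orthogonal C" "\<And>x. x \<in> C \<Longrightarrow> norm x = 1"
      "independent C" "card C = dim Z1" "span C = Z1"
    by (rule orthonormal_basis_subspace[OF sub]) (rule that)
  have finC: "finite C" using C(4) independent_imp_finite by blast
  have CZ: "pr x = x" "\<psi> x = 0" if "x \<in> C" for x using that C(1) prZ \<psi>Z by auto
  have dimsum: "dim Z1 + DIM('k) = DIM('a)"
  proof -
    have 1: "{x + y |x y. x \<in> Z1 \<and> y \<in> range \<phi>} = UNIV"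
    proof -
      have "v = (v - \<phi> (\<psi> v)) + \<phi> (\<psi> v)" for v by simp
      then have "v \<in> {x + y |x y. x \<in> Z1 \<and> y \<in> range \<phi>}" for v using \<psi>[of v] by blast
      then show ?thesis by (intro equalityI subsetI) simp_all
    qed
    have "subspace (range \<phi>)" using linear_subspace_image[OF lin subspace_UNIV] .
    then have "dim {x + y |x y. x \<in> Z1 \<and> y \<in> range \<phi>} + dim (Z1 \<inter> range \<phi>) = dim Z1 + dim (range \<phi>)"
      by (rule dim_sums_Int[OF sub])
    moreover have "dim (range \<phi>) = DIM('k)" using dim_image_eq[OF lin, of UNIV] inj by simp
    ultimately show ?thesis by (simp add: 1 disj)
  qed
  have sg: "has_signature B 2 (DIM('a) - 2)"
  proof (rule has_signatureI[OF B, where N = "\<phi> ` N" and P = "\<phi> ` P \<union> C"])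
    show "finite (\<phi> ` N)" "finite (\<phi> ` P \<union> C)" using NP finC by auto
    have "B x y = 0" if "x \<in> \<phi> ` (N \<union> P) \<union> C" "y \<in> \<phi> ` (N \<union> P) \<union> C" "x \<noteq> y" for x y
    proof -
      have "B (\<phi> a) (\<phi> b) = 0" if "a \<in> N \<union> P" "b \<in> N \<union> P" "\<phi> a \<noteq> \<phi> b" for a b
      proof -
        have "a \<noteq> b" using that(3) by blast
        then show ?thesis using pairwiseD[OF NP(3) that(1,2)] by (simp add: B\<phi> \<psi>\<phi>)
      qed
      moreover have "B (\<phi> a) b = 0" if "b \<in> C" for a b
        by (simp add: B\<phi>' CZ[OF that] bilinear_rzero[OF Bk])
      moreover have "B a b = 0" if "a \<in> C" "b \<in> C" "a \<noteq> b" for a b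
        using that C(2) by (simp add: B_def CZ bilinear_rzero[OF Bk] pairwise_def orthogonal_def)
      moreover have "B b (\<phi> a) = 0" if "b \<in> C" for a b
        by (simp add: B\<phi> CZ[OF that] bilinear_lzero[OF Bk])
      ultimately show ?thesis using that by (elim UnE imageE) simp_all
    qed
    then show "pairwise (\<lambda>x y. B x y = 0) (\<phi> ` N \<union> (\<phi> ` P \<union> C))"
      by (auto simp: pairwise_def)
    show "B x x < 0" if "x \<in> \<phi> ` N" for x using that NP(5) by (auto simp: B\<phi> \<psi>\<phi>)
    have "0 < B x x" if "x \<in> C" for x
      by (simp add: B_def CZ[OF that] bilinear_rzero[OF Bk] dot_square_norm C(3)[OF that])
    then show "0 < B x x" if "x \<in> \<phi> ` P \<union> C" for x
      using that NP(7) by (auto simp: B\<phi> \<psi>\<phi>)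
    have inj': "inj_on \<phi> S" for S by (rule inj_on_subset[OF inj subset_UNIV])
    show "card (\<phi> ` N) = 2" using NP inj' by (simp add: card_image)
    have "x \<noteq> 0" if "x \<in> C" for x using C(3)[OF that] by auto
    then have "\<phi> ` P \<inter> C = {}" using disj C(1) by blast
    then show "card (\<phi> ` P \<union> C) = DIM('a) - 2"
      using NP finC inj' C(5) dimsum dimk by (simp add: card_Un_disjoint card_image)
    show "2 + (DIM('a) - 2) = DIM('a)" using dimsum dimk by simp
  qed
  show ?thesis using pm fl sg dm unfolding admissible_metric_def by blast
qed

text \<open>The negative of the flat Lorentzian metric with isotropic center.\<close>

definition H3_metric :: "real^3 \<Rightarrow> real^3 \<Rightarrow> real" where
  "H3_metric u v = u$1 * v$3 + u$3 * v$1 - u$2 * v$2"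

lemma H3_bracket_nth [simp]:
  "H3_bracket u v $ 1 = 0" "H3_bracket u v $ 2 = 0" "H3_bracket u v $ 3 = u$1 * v$2 - u$2 * v$1"
  by (simp_all add: H3_bracket_def axis_def)

lemma L64_bracket_nth [simp]:
  "L64_bracket u v $ 1 = 0" "L64_bracket u v $ 2 = 0" "L64_bracket u v $ 3 = 0" "L64_bracket u v $ 4 = 0"
  "L64_bracket u v $ 5 = u$1 * v$2 - u$2 * v$1"
  "L64_bracket u v $ 6 = u$1 * v$3 - u$3 * v$1 + u$2 * v$4 - u$4 * v$2"
  by (simp_all add: L64_bracket_def axis_def)

lemma bilinear_H3_bracket: "bilinear H3_bracket"
  unfolding bilinear_def
  by (intro conjI allI linearI) (simp_all add: vec_eq_iff forall_3 algebra_simps)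

lemma bilinear_L64_bracket: "bilinear L64_bracket"
  unfolding bilinear_def
  by (intro conjI allI linearI) (simp_all add: vec_eq_iff forall_6 algebra_simps)

lemma admissible_H3_metric: "admissible_metric H3_bracket H3_metric"
proof -
  have B: "bilinear H3_metric" unfolding bilinear_def
    by (intro conjI allI linearI) (simp_all add: H3_metric_def algebra_simps)
  have pm: "pseudo_euclidean_metric H3_metric" unfolding pseudo_euclidean_metric_def
  proof (intro conjI allI impI B)
    fix x assume "\<forall>y. H3_metric x y = 0"
    \<comment> \<open>The test vector is chosen so that the pairing is the Euclidean square of \<open>x\<close>.\<close>
    then have "H3_metric x (vector [x$3, - x$2, x$1]) = 0" by blast
    then have "x$1 * x$1 + x$2 * x$2 + x$3 * x$3 = 0" by (simp add: H3_metric_def)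
    then show "x = 0" by (simp add: vec_eq_iff forall_3 add_nonneg_eq_0_iff)
  qed (simp add: H3_metric_def)
  \<comment> \<open>The coordinates are the coefficients of \<open>w\<close> in the Koszul formula, read off against the dual basis.\<close>
  have lc: "levi_civita H3_bracket H3_metric u v = vector [0, u$1 * v$1, u$1 * v$2]" for u v
    by (rule levi_civita_eqI[OF pm]) (simp add: H3_metric_def algebra_simps)
  have fl: "flat_metric H3_bracket H3_metric"
    unfolding flat_metric_def lc by (simp add: vec_eq_iff forall_3)
  have sg: "has_signature H3_metric 2 (DIM(real^3) - 2)"
  proof (rule has_signatureI[OF B, where N = "{vector [0,1,0], vector [1,0,-1]}" and P = "{vector [1,0,1]}"])
    have "vector [0,1,0] \<noteq> (vector [1,0,-1] :: real^3)" by (simp add: vec_eq_iff forall_3)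
    then show "card {vector [0,1,0], vector [1,0,-1] :: real^3} = 2" by simp
  qed (auto simp: H3_metric_def pairwise_def)
  have "lie_center H3_bracket \<inter> metric_orthogonal H3_metric (lie_center H3_bracket) = span {axis 3 1}"
  proof -
    have cn: "lie_center H3_bracket = {z. z$1 = 0 \<and> z$2 = 0}"
    proof -
      have "z$1 = 0 \<and> z$2 = 0" if "\<forall>x. H3_bracket z x = 0" for z
      proof -
        have "H3_bracket z (vector [- z$2, z$1, 0]) $ 3 = 0" using that by simp
        then show ?thesis by (simp add: sum_squares_eq_zero_iff)
      qed
      moreover have "H3_bracket z x = 0" if "z$1 = 0 \<and> z$2 = 0" for z x
        using that by (simp add: vec_eq_iff forall_3)
      ultimately show ?thesis unfolding lie_center_def by blast
    qed
    have "z = z$3 *\<^sub>R axis 3 1" if "z$1 = 0 \<and> z$2 = 0" for z :: "real^3"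
      using that by (simp add: vec_eq_iff forall_3 axis_def)
    then show ?thesis
      by (auto simp: cn metric_orthogonal_def H3_metric_def span_singleton) (auto simp: axis_def)
  qed
  moreover have "dim (span {axis 3 1 :: real^3}) = 1" by (simp add: axis_eq_0_iff)
  ultimately show ?thesis using pm fl sg by (simp add: admissible_metric_def)
qed

text \<open>The quadratic form of \<open>metric0 0 1 0 1\<close>.\<close>

definition L64_metric :: "real^6 \<Rightarrow> real^6 \<Rightarrow> real" where
  "L64_metric u v = u$1 * v$6 + u$6 * v$1 + u$2 * v$3 + u$3 * v$2 + u$4 * v$4 + u$5 * v$5 / 3"

lemma admissible_L64_metric: "admissible_metric L64_bracket L64_metric"
proof -
  have B: "bilinear L64_metric" unfolding bilinear_def
    by (intro conjI allI linearI) (simp_all add: L64_metric_def algebra_simps)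
  have pm: "pseudo_euclidean_metric L64_metric" unfolding pseudo_euclidean_metric_def
  proof (intro conjI allI impI B)
    fix x assume "\<forall>y. L64_metric x y = 0"
    then have "L64_metric x (vector [x$6, x$3, x$2, x$4, 3 * x$5, x$1]) = 0" by blast
    then have "x$1 * x$1 + x$2 * x$2 + x$3 * x$3 + x$4 * x$4 + x$5 * x$5 + x$6 * x$6 = 0"
      by (simp add: L64_metric_def)
    then show "x = 0" by (simp add: vec_eq_iff forall_6 add_nonneg_eq_0_iff)
  qed (simp add: L64_metric_def)
  \<comment> \<open>As before, each coordinate is a coefficient of \<open>w\<close> in the Koszul formula.\<close>
  have lc: "levi_civita L64_bracket L64_metric u v =
     vector [0, - u$1 * v$1, (u$4 * v$1 + u$1 * v$4 - (u$1 * v$5 + u$5 * v$1) / 3) / 2,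
       - (u$2 * v$1 + u$1 * v$2) / 2, (u$1 * v$2 - u$2 * v$1) / 2,
       (u$1 * v$3 - u$3 * v$1 + u$2 * v$4 - u$4 * v$2 + (u$2 * v$5 + u$5 * v$2) / 3
         + u$3 * v$1 + u$1 * v$3) / 2]" for u v
    by (rule levi_civita_eqI[OF pm]) (simp add: L64_metric_def field_simps)
  have fl: "flat_metric L64_bracket L64_metric"
    unfolding flat_metric_def lc by (simp add: vec_eq_iff forall_6 field_simps)
  have sg: "has_signature L64_metric 2 (DIM(real^6) - 2)"
  \<comment> \<open>The two hyperbolic planes of coordinates 1, 6 and 2, 3 give one negative and one positive
    direction each.\<close>
  proof (rule has_signatureI[OF B, where N = "{vector [1,0,0,0,0,-1], vector [0,1,-1,0,0,0]}"
        and P = "{vector [1,0,0,0,0,1], vector [0,1,1,0,0,0], vector [0,0,0,1,0,0], vector [0,0,0,0,1,0]}"])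
    have "vector [1,0,0,0,0,-1] \<noteq> (vector [0,1,-1,0,0,0] :: real^6)" by (simp add: vec_eq_iff forall_6)
    then show "card {vector [1,0,0,0,0,-1], vector [0,1,-1,0,0,0] :: real^6} = 2" by simp
    show "card {vector [1,0,0,0,0,1], vector [0,1,1,0,0,0], vector [0,0,0,1,0,0], vector [0,0,0,0,1,0] :: real^6}
      = DIM(real^6) - 2"
      by (simp add: card_insert_if vec_eq_iff forall_6)
  qed (auto simp: L64_metric_def pairwise_def)
  have "lie_center L64_bracket \<inter> metric_orthogonal L64_metric (lie_center L64_bracket) = span {axis 6 1}"
  proof -
    have cn: "lie_center L64_bracket = {z. z$1 = 0 \<and> z$2 = 0 \<and> z$3 = 0 \<and> z$4 = 0}"
    proof -
      have "z$1 = 0 \<and> z$2 = 0 \<and> z$3 = 0 \<and> z$4 = 0" if z: "\<forall>x. L64_bracket z x = 0" for z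
      proof -
        have "L64_bracket z (vector [- z$2, z$1, 0, 0, 0, 0]) $ 5 = 0" using z by simp
        then have 1: "z$1 = 0 \<and> z$2 = 0" by (simp add: sum_squares_eq_zero_iff)
        have "L64_bracket z (vector [z$3, z$4, 0, 0, 0, 0]) $ 6 = 0" using z by simp
        moreover have "L64_bracket z (vector [z$3, z$4, 0, 0, 0, 0]) $ 6 = - (z$3 * z$3 + z$4 * z$4)"
          by simp
        ultimately have "z$3 * z$3 + z$4 * z$4 = 0" by (simp only: neg_equal_0_iff_equal)
        then show ?thesis using 1 sum_squares_eq_zero_iff by blast
      qed
      moreover have "L64_bracket z x = 0" if "z$1 = 0 \<and> z$2 = 0 \<and> z$3 = 0 \<and> z$4 = 0" for z x
        using that by (simp add: vec_eq_iff forall_6)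
      ultimately show ?thesis unfolding lie_center_def by blast
    qed
    have "z \<in> span {axis 6 1}"
      if "z \<in> lie_center L64_bracket" "z \<in> metric_orthogonal L64_metric (lie_center L64_bracket)" for z
    proof -
      have "vector [0,0,0,0,1,0] \<in> lie_center L64_bracket" by (simp add: cn)
      then have "L64_metric z (vector [0,0,0,0,1,0]) = 0" using that(2) by (auto simp: metric_orthogonal_def)
      then have "z = z$6 *\<^sub>R axis 6 1"
        using that(1) by (simp add: L64_metric_def cn vec_eq_iff forall_6 axis_def)
      then show ?thesis by (metis rangeI span_singleton)
    qed
    moreover have "r *\<^sub>R axis 6 1 \<in> lie_center L64_bracket \<inter> metric_orthogonal L64_metric (lie_center L64_bracket)" for r
      by (simp add: cn metric_orthogonal_def L64_metric_def axis_def)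
    ultimately show ?thesis by (auto simp: span_singleton)
  qed
  moreover have "dim (span {axis 6 1 :: real^6}) = 1" by (simp add: axis_eq_0_iff)
  ultimately show ?thesis using pm fl sg by (simp add: admissible_metric_def)
qed

section \<open>Flatness as a quadratic identity\<close>

text \<open>Such a subspace meets the span of the positive part of an orthogonal basis only in 0, since on that
  span the form is a sum of squares with positive weights.\<close>

lemma negative_semidefinite_dim_le:
  fixes B :: "'a::euclidean_space \<Rightarrow> 'a \<Rightarrow> real"
  assumes B: "bilinear B" and sg: "has_signature B p q"
    and S: "subspace S" and neg: "\<And>x. x \<in> S \<Longrightarrow> B x x \<le> 0"
  shows "dim S \<le> p"
proof -
  obtain N P where NP: "finite N" "finite P" "N \<inter> P = {}" "independent (N \<union> P)" "span (N \<union> P) = UNIV"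
      "pairwise (\<lambda>x y. B x y = 0) (N \<union> P)" "card N = p" "card P = q" "\<forall>x\<in>P. B x x > 0"
    using sg unfolding has_signature_def by (elim exE conjE) (rule that)
  have indP: "independent P" using NP(4) independent_mono by blast
  have pos: "x = 0" if x: "x \<in> span P" and le: "B x x \<le> 0" for x
  proof -
    obtain c where c: "x = (\<Sum>v\<in>P. c v *\<^sub>R v)" using x span_finite[OF NP(2)] by auto
    have comp: "B v x = c v * B v v" if v: "v \<in> P" for v
    proof -
      have "linear (B v)" using B by (simp add: bilinear_def)
      from linear_sum[OF this, of "\<lambda>u. c u *\<^sub>R u" P] have "B v x = (\<Sum>u\<in>P. c u * B v u)"
        by (simp add: c bilinear_rmul[OF B])
      also have "\<dots> = c v * B v v"
      proof -
        have "B v u = 0" if "u \<in> P - {v}" for u using that v by (intro pairwiseD[OF NP(6)]) auto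
        then have "(\<Sum>u\<in>P - {v}. c u * B v u) = 0" by (intro sum.neutral) simp
        then show ?thesis by (simp add: sum.remove[OF NP(2) v])
      qed
      finally show ?thesis .
    qed
    have "B x x = (\<Sum>v\<in>P. c v * B v x)" using bilinear_real_sum_left[OF B, of c P x] c by simp
    also have "\<dots> = (\<Sum>v\<in>P. (c v)\<^sup>2 * B v v)" by (simp add: comp power2_eq_square mult.assoc)
    finally have eq: "B x x = (\<Sum>v\<in>P. (c v)\<^sup>2 * B v v)" .
    have nn: "0 \<le> (c v)\<^sup>2 * B v v" if "v \<in> P" for v using NP(9) that by (simp add: less_imp_le)
    have "0 \<le> (\<Sum>v\<in>P. (c v)\<^sup>2 * B v v)" by (rule sum_nonneg) (rule nn)
    then have "(\<Sum>v\<in>P. (c v)\<^sup>2 * B v v) = 0" using eq le by linarith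
    then have z: "(c v)\<^sup>2 * B v v = 0" if "v \<in> P" for v
      using sum_nonneg_eq_0_iff[OF NP(2), of "\<lambda>v. (c v)\<^sup>2 * B v v"] nn that by simp
    have "c v = 0" if v: "v \<in> P" for v
    proof -
      have "B v v > 0" using NP(9) v by blast
      then show ?thesis using z[OF v] by simp
    qed
    then show "x = 0" by (simp add: c)
  qed
  have "S \<inter> span P \<subseteq> {0}" using pos neg by blast
  then have "dim (S \<inter> span P) = 0" by (metis dim_eq_0)
  moreover have "dim {x + y |x y. x \<in> S \<and> y \<in> span P} + dim (S \<inter> span P) = dim S + dim (span P)"
    by (rule dim_sums_Int[OF S subspace_span])
  moreover have "dim (span P) = q" using indP NP(8) by (simp add: dim_eq_card_independent)
  moreover have "dim {x + y |x y. x \<in> S \<and> y \<in> span P} \<le> DIM('a)" by (rule dim_subset_UNIV)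
  moreover have "DIM('a) = p + q"
  proof -
    have "dim (UNIV :: 'a set) = card (N \<union> P)"
      unfolding NP(5)[symmetric] dim_span by (rule dim_eq_card_independent[OF NP(4)])
    then show ?thesis using NP by (simp add: card_Un_disjoint)
  qed
  ultimately show ?thesis by linarith
qed

text \<open>Otherwise the three vectors would span a negative semidefinite subspace of dimension three.\<close>

lemma index_two_isotropic_plane_maximal:
  fixes B :: "'a::euclidean_space \<Rightarrow> 'a \<Rightarrow> real"
  assumes B: "bilinear B" and sym: "\<And>x y. B x y = B y x" and sg: "has_signature B 2 q"
    and iso: "B e e = 0" "B f f = 0" "B e f = 0" and ind: "e \<noteq> 0" "f \<notin> span {e}"
    and z: "B e z = 0" "B f z = 0" "B z z \<le> 0"
  obtains p r where "z = p *\<^sub>R e + r *\<^sub>R f"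
proof -
  have "z \<in> span {f, e}"
  proof (rule ccontr)
    assume nz: "z \<notin> span {f, e}"
    have "independent {z, f, e}" using ind nz by (auto simp: independent_insert)
    moreover have "z \<noteq> f" "z \<noteq> e" "f \<noteq> e" using ind(2) nz by (auto simp: span_base)
    ultimately have "dim (span {z, f, e}) = 3" by (simp add: dim_eq_card_independent)
    moreover have "dim (span {z, f, e}) \<le> 2"
    proof (rule negative_semidefinite_dim_le[OF B sg subspace_span])
      fix x assume "x \<in> span {z, f, e}"
      then obtain k1 k2 k3 where "x - k1 *\<^sub>R z - k2 *\<^sub>R f = k3 *\<^sub>R e"
        by (auto simp: span_insert span_singleton algebra_simps)
      then have x: "x = k1 *\<^sub>R z + k2 *\<^sub>R f + k3 *\<^sub>R e" by (simp add: algebra_simps)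
      have "B z e = 0" "B z f = 0" "B f e = 0" using z iso sym by metis+
      then have "B x x = k1 * k1 * B z z"
        unfolding x by (simp add: bilinear_ladd[OF B] bilinear_radd[OF B] bilinear_lmul[OF B]
            bilinear_rmul[OF B] iso z)
      then show "B x x \<le> 0" using z(3) by (simp add: mult_nonneg_nonpos)
    qed
    ultimately show False by simp
  qed
  then obtain r p where "z - r *\<^sub>R f = p *\<^sub>R e" by (auto simp: span_insert span_singleton)
  then have "z = p *\<^sub>R e + r *\<^sub>R f" by (simp add: algebra_simps)
  then show thesis by (rule that)
qed

text \<open>The one-dimensional radical of the restriction of the metric to the center is represented by a
  spanning vector \<open>e\<close>, which is determined up to scaling.\<close>

locale flat_two_step =
  fixes br :: "'a::euclidean_space \<Rightarrow> 'a \<Rightarrow> 'a" and B :: "'a \<Rightarrow> 'a \<Rightarrow> real" and e :: 'a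
  assumes lie: "lie_algebra br" and two_step: "two_step_nilpotent br"
    and pseudo: "pseudo_euclidean_metric B" and flat: "flat_metric br B"
    and signature: "has_signature B 2 (DIM('a) - 2)"
    and e_nonzero: "e \<noteq> 0"
    and radical: "lie_center br \<inter> metric_orthogonal B (lie_center br) = span {e}"
begin

lemma bil_br: "bilinear br" using lie by (simp add: lie_algebra_def)
lemma bil: "bilinear B" using pseudo by (simp add: pseudo_euclidean_metric_def)
lemma sym: "B x y = B y x" using pseudo by (simp add: pseudo_euclidean_metric_def)

lemmas expand = bilinear_ladd[OF bil] bilinear_radd[OF bil] bilinear_lmul[OF bil] bilinear_rmul[OF bil]
  bilinear_lsub[OF bil] bilinear_rsub[OF bil] bilinear_lneg[OF bil] bilinear_rneg[OF bil]
  bilinear_lzero[OF bil] bilinear_rzero[OF bil]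

lemmas expand_br = bilinear_ladd[OF bil_br] bilinear_radd[OF bil_br] bilinear_lmul[OF bil_br]
  bilinear_rmul[OF bil_br] bilinear_lsub[OF bil_br] bilinear_rsub[OF bil_br] bilinear_lneg[OF bil_br]
  bilinear_rneg[OF bil_br] bilinear_lzero[OF bil_br] bilinear_rzero[OF bil_br]

lemma br_self [simp]: "br x x = 0" using lie by (simp add: lie_algebra_def)

lemma br_skew: "br y x = - br x y"
proof -
  have "br (x + y) (x + y) = br x x + br x y + (br y x + br y y)" by (simp only: expand_br add_ac)
  then have "br x y + br y x = 0" by simp
  then show ?thesis by (simp add: eq_neg_iff_add_eq_0 add.commute)
qed

lemma center_br: "z \<in> lie_center br \<Longrightarrow> br z x = 0" "z \<in> lie_center br \<Longrightarrow> br x z = 0"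
  using lie_center_bracket[OF lie] by blast+

lemma br_in_center: "br x y \<in> lie_center br"
proof -
  have "br x y \<in> derived_algebra br" unfolding derived_algebra_def by (intro span_base) blast
  then show ?thesis using two_step by (auto simp: two_step_nilpotent_def)
qed

lemma e_center: "e \<in> lie_center br" and e_orth_center: "z \<in> lie_center br \<Longrightarrow> B e z = 0"
proof -
  have "e \<in> lie_center br \<inter> metric_orthogonal B (lie_center br)"
    unfolding radical by (simp add: span_base)
  then show "e \<in> lie_center br" "z \<in> lie_center br \<Longrightarrow> B e z = 0"
    by (auto simp: metric_orthogonal_def)
qed

lemma in_radical:
  assumes "z \<in> lie_center br" "\<And>y. y \<in> lie_center br \<Longrightarrow> B z y = 0"
  obtains r where "z = r *\<^sub>R e"
proof -
  have "z \<in> span {e}" unfolding radical[symmetric] using assms by (simp add: metric_orthogonal_def)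
  then show thesis using that by (auto simp: span_singleton)
qed

lemma eqI: "(\<And>w. B x w = B y w) \<Longrightarrow> x = y"
  by (rule pseudo_euclidean_metric_eqI[OF pseudo])

text \<open>Doubling the product keeps halves out of all later formulas.\<close>

definition Q :: "'a \<Rightarrow> 'a \<Rightarrow> 'a" where "Q u v = 2 *\<^sub>R levi_civita br B u v"

lemma koszul: "B (Q u v) w = B (br u v) w + B (br w u) v + B (br w v) u"
  unfolding Q_def by (simp add: expand levi_civita_koszul[OF pseudo bil_br])

lemma Q_eqI: "(\<And>w. B z w = B (br u v) w + B (br w u) v + B (br w v) u) \<Longrightarrow> Q u v = z"
  by (rule eqI) (simp add: koszul)

text \<open>The Levi-Civita product is compatible with the metric: exchanging \<open>v\<close> and \<open>w\<close> in the Koszul formula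
  changes all signs.\<close>

lemma levi_civita_skew: "B (levi_civita br B u v) w = - B v (levi_civita br B u w)"
proof -
  let ?l = "levi_civita br B"
  have "2 * B (?l u v) w = B (br u v) w + B (br w u) v + B (br w v) u"
    by (rule levi_civita_koszul[OF pseudo bil_br])
  moreover have "2 * B (?l u w) v = B (br u w) v + B (br v u) w + B (br v w) u"
    by (rule levi_civita_koszul[OF pseudo bil_br])
  moreover have "br u w = - br w u" "br v u = - br u v" "br v w = - br w v" by (rule br_skew)+
  ultimately have "2 * B (?l u v) w = - (2 * B (?l u w) v)" by (simp add: expand)
  then show ?thesis using sym[of v "?l u w"] by simp
qed

text \<open>Moving the outer left multiplication to the other argument by skewness turns the commutator of left
  multiplications into inner products of single products. On the left only one Koszul term survives
  because \<open>br u v\<close> is central.\<close>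

lemma flat_eq: "2 * B (br x w) (br u v) = B (Q u w) (Q v x) - B (Q v w) (Q u x)"
proof -
  let ?l = "levi_civita br B"
  have "?l (br u v) w = ?l u (?l v w) - ?l v (?l u w)" using flat by (simp add: flat_metric_def)
  then have "B (?l (br u v) w) x = - B (?l v w) (?l u x) + B (?l u w) (?l v x)"
    by (simp add: expand levi_civita_skew[of _ "?l _ _"])
  moreover have "2 * B (?l (br u v) w) x = B (br x w) (br u v)"
    using levi_civita_koszul[OF pseudo bil_br, of "br u v" w x]
    by (simp add: center_br[OF br_in_center] expand)
  ultimately have "B (br x w) (br u v) = 2 * B (?l u w) (?l v x) - 2 * B (?l v w) (?l u x)" by linarith
  then show ?thesis unfolding Q_def by (simp add: expand)
qed

lemma adjoint_exists:
  assumes "linear \<omega>" obtains j where "\<And>w. B j w = \<omega> w"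
  using pseudo_euclidean_metric_represents[OF pseudo assms] by blast

definition J :: "'a \<Rightarrow> 'a \<Rightarrow> 'a" where "J z v = (SOME j. \<forall>w. B j w = B (br v w) z)"

lemma B_J: "B (J z v) w = B (br v w) z"
proof -
  have "linear (\<lambda>w. B (br v w) z)" by (rule linearI) (simp_all add: expand expand_br)
  then obtain j where "\<And>w. B j w = B (br v w) z" by (rule adjoint_exists) (rule that)
  then have "\<exists>j. \<forall>w. B j w = B (br v w) z" by blast
  then have "\<forall>w. B (J z v) w = B (br v w) z" unfolding J_def by (rule someI_ex)
  then show ?thesis by blast
qed

text \<open>For central \<open>z\<close> and \<open>z'\<close> the product \<open>Q z z'\<close> vanishes, while \<open>Q z\<close> and \<open>Q _ z'\<close> are \<open>- J z\<close> and
  \<open>- J z'\<close>; so only one term of the flatness identity is left.\<close>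

lemma central_J_isotropic:
  assumes "z \<in> lie_center br" "z' \<in> lie_center br"
  shows "B (J z' v) (J z x) = 0"
proof -
  have 1: "Q z x = - J z x" for x
    by (rule Q_eqI) (simp add: expand B_J center_br[OF assms(1)] br_skew[of _ x])
  have 2: "Q v z' = - J z' v" for v
    by (rule Q_eqI) (simp add: expand B_J center_br[OF assms(2)] br_skew[of _ v])
  have 3: "Q z z' = 0"
    by (rule Q_eqI) (simp add: expand center_br[OF assms(2)] center_br[OF assms(1)])
  have "B (Q v z') (Q z x) = 0"
    using flat_eq[of x z' z v] by (simp add: 3 center_br[OF assms(1)] expand)
  then show ?thesis by (simp only: expand 1 2 minus_minus)
qed

lemma dual_vector: obtains e' where "B e e' = 1"
proof -
  have "(\<forall>y. B e y = 0) \<longrightarrow> e = 0" using pseudo unfolding pseudo_euclidean_metric_def by blast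
  then obtain y where "B e y \<noteq> 0" using e_nonzero by blast
  then have "B e ((1 / B e y) *\<^sub>R y) = 1" by (simp add: expand)
  then show thesis by (rule that)
qed

lemma isotropic_plane_maximal:
  assumes "B e f = 0" "B f f = 0" "f \<notin> span {e}" "B e z = 0" "B f z = 0" "B z z \<le> 0"
  obtains p r where "z = p *\<^sub>R e + r *\<^sub>R f"
  by (rule index_two_isotropic_plane_maximal[OF bil sym signature e_orth_center[OF e_center] assms(2,1)
      e_nonzero assms(3-6)]) (rule that)

end

section \<open>Derived algebra inside the radical\<close>

context flat_two_step
begin

lemma subspace_center: "subspace (lie_center br)"
  by (simp add: subspace_def lie_center_def expand_br)

text \<open>Here the bracket is \<open>\<omega>(v, w) e\<close> with a scalar 2-form \<open>\<omega>\<close>. It vanishes on \<open>e\<^sup>\<bottom>\<close> (\<open>lag\<close> below), hence is the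
  exterior product of \<open>\<langle>e, _\<rangle>\<close> and \<open>\<omega>(e', _)\<close>, and \<open>e'\<close>, a vector \<open>y0\<close> dual to the second factor, and \<open>e\<close>
  span the Heisenberg algebra.\<close>

lemma degenerate_derived_algebra:
  assumes deg: "\<And>v w z. z \<in> lie_center br \<Longrightarrow> B (br v w) z = 0"
  shows "\<exists>\<phi> Z1. central_splitting br H3_bracket \<phi> Z1" and "\<exists>r. br v w = r *\<^sub>R e"
proof -
  obtain e' where e': "B e e' = 1" by (rule dual_vector)
  define \<omega> where "\<omega> v w = B (br v w) e'" for v w
  have br_\<omega>: "br v w = \<omega> v w *\<^sub>R e" for v w
  proof -
    obtain r where "br v w = r *\<^sub>R e" using deg by (rule in_radical[OF br_in_center])
    then show ?thesis by (simp add: \<omega>_def expand e')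
  qed
  then show "\<exists>r. br v w = r *\<^sub>R e" by blast
  have \<omega>_expand: "\<omega> (x + y) w = \<omega> x w + \<omega> y w" "\<omega> w (x + y) = \<omega> w x + \<omega> w y"
    "\<omega> (x - y) w = \<omega> x w - \<omega> y w" "\<omega> w (x - y) = \<omega> w x - \<omega> w y"
    "\<omega> (s *\<^sub>R x) w = s * \<omega> x w" "\<omega> w (s *\<^sub>R x) = s * \<omega> w x" for x y w s
    by (simp_all add: \<omega>_def expand expand_br)
  have \<omega>_self [simp]: "\<omega> x x = 0" for x by (simp add: \<omega>_def expand)
  have \<omega>_skew: "\<omega> y x = - \<omega> x y" for x y unfolding \<omega>_def br_skew[of y x] by (simp add: expand)
  have \<omega>_e [simp]: "\<omega> e x = 0" "\<omega> x e = 0" for x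
    by (simp_all add: \<omega>_def center_br[OF e_center] expand)
  define j where "j = J e'"
  have B_j: "B (j v) w = \<omega> v w" for v w by (simp add: j_def B_J \<omega>_def)
  have B_j': "B w (j v) = \<omega> v w" for v w by (simp add: sym[of w] B_j)
  have ee: "B e e = 0" by (rule e_orth_center[OF e_center])
  have Q: "Q u v = \<omega> u v *\<^sub>R e - B e v *\<^sub>R j u - B e u *\<^sub>R j v" for u v
  proof (rule Q_eqI)
    fix w
    show "B (\<omega> u v *\<^sub>R e - B e v *\<^sub>R j u - B e u *\<^sub>R j v) w = B (br u v) w + B (br w u) v + B (br w v) u"
      by (simp add: br_\<omega> expand B_j \<omega>_skew[of u w] \<omega>_skew[of v w])
  qed
  have iso: "B (j u) (j x) = 0" if "B e u = 0" "B e x = 0" for u x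
  proof -
    have je: "B e (j v) = 0" "B (j v) e = 0" for v by (simp_all add: B_j B_j')
    have 1: "Q u e' = \<omega> u e' *\<^sub>R e - j u" "Q e' x = \<omega> e' x *\<^sub>R e - j x"
      "Q e' e' = - 2 *\<^sub>R j e'" "Q u x = \<omega> u x *\<^sub>R e"
      by (simp_all add: Q that e' scaleR_2)
    have "2 * B (br x e') (br u e') = B (Q u e') (Q e' x) - B (Q e' e') (Q u x)" by (rule flat_eq)
    then show ?thesis unfolding 1 br_\<omega> by (simp add: expand ee je)
  qed
  have lag: "\<omega> u v = 0" if u: "B e u = 0" and v: "B e v = 0" for u v
  proof (rule ccontr)
    \<comment> \<open>Since \<open>v\<close> is orthogonal to \<open>e\<close> but not to \<open>j u\<close>, the vectors \<open>e\<close> and \<open>j u\<close> span a maximal isotropic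
      plane, which contains \<open>j v\<close>. Both \<open>e\<close> and \<open>j u\<close> are orthogonal to \<open>u\<close>, contradicting \<open>\<omega> v u \<noteq> 0\<close>.\<close>
    assume nz: "\<omega> u v \<noteq> 0"
    have "j u \<notin> span {e}"
    proof
      assume "j u \<in> span {e}"
      then obtain r where "j u = r *\<^sub>R e" by (auto simp: span_singleton)
      then have "\<omega> u v = 0" using B_j[of u v] by (simp add: expand v)
      then show False using nz by simp
    qed
    moreover have "B e (j u) = 0" "B e (j v) = 0" by (simp_all add: B_j')
    moreover have "B (j u) (j u) = 0" "B (j u) (j v) = 0" "B (j v) (j v) \<le> 0" using iso u v by simp_all
    ultimately obtain p r where "j v = p *\<^sub>R e + r *\<^sub>R j u"
      using isotropic_plane_maximal[of "j u" "j v"] by blast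
    then have "\<omega> v u = 0" using B_j[of v u] by (simp add: expand u B_j)
    then show False using nz \<omega>_skew[of v u] by simp
  qed
  have split: "\<omega> u v = B e u * \<omega> e' v - B e v * \<omega> e' u" for u v
  proof -
    have "\<omega> (u - B e u *\<^sub>R e') (v - B e v *\<^sub>R e') = 0" by (rule lag) (simp_all add: expand e')
    then show ?thesis by (simp add: \<omega>_expand \<omega>_skew[of u e'])
  qed
  obtain x y where "br x y \<noteq> 0" using two_step by (auto simp: two_step_nilpotent_def)
  then have "\<omega> x y \<noteq> 0" by (simp add: br_\<omega>)
  then obtain w where w: "\<omega> e' w \<noteq> 0" using split[of x y] by fastforce
  define y0 where "y0 = (1 / \<omega> e' w) *\<^sub>R (w - B e w *\<^sub>R e')"
  have y0: "\<omega> e' y0 = 1" "\<omega> y0 e' = -1" "B e y0 = 0"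
    using w by (simp_all add: y0_def \<omega>_expand expand e' \<omega>_skew[of w e'])
  define \<phi> where "\<phi> l = l$1 *\<^sub>R e' + l$2 *\<^sub>R y0 + l$3 *\<^sub>R e" for l :: "real^3"
  define Z1 where "Z1 = {z \<in> lie_center br. B z e' = 0}"
  have "central_splitting br H3_bracket \<phi> Z1"
  proof (rule central_splittingI)
    show "linear \<phi>" by (rule linearI) (simp_all add: \<phi>_def algebra_simps)
    show "br (\<phi> u) (\<phi> v) = \<phi> (H3_bracket u v)" for u v
      by (simp add: br_\<omega> \<phi>_def \<omega>_expand y0 algebra_simps)
    show "subspace Z1" using subspace_center unfolding Z1_def subspace_def by (simp add: expand)
    show "Z1 \<subseteq> lie_center br" by (auto simp: Z1_def)
    show "l = 0" if "\<phi> l \<in> Z1" for l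
    proof -
      have cen: "\<phi> l \<in> lie_center br" and 0: "B (\<phi> l) e' = 0" using that by (auto simp: Z1_def)
      have 1: "l$1 = 0" using e_orth_center[OF cen] by (simp add: \<phi>_def expand e' y0 ee)
      have "\<omega> e' (\<phi> l) = 0" by (simp add: \<omega>_def center_br[OF cen] expand)
      then have 2: "l$2 = 0" by (simp add: \<phi>_def \<omega>_expand y0)
      have "l$3 = 0" using 0 by (simp add: \<phi>_def expand e' 1 2)
      with 1 2 show ?thesis by (simp add: vec_eq_iff forall_3)
    qed
    show "\<exists>l. v - \<phi> l \<in> Z1" for v
    proof -
      define l3 where "l3 = B (v - B e v *\<^sub>R e' - \<omega> e' v *\<^sub>R y0) e'"
      define l :: "real^3" where "l = vector [B e v, \<omega> e' v, l3]"
      have v': "v - \<phi> l = v - B e v *\<^sub>R e' - \<omega> e' v *\<^sub>R y0 - l3 *\<^sub>R e"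
        by (simp add: \<phi>_def l_def)
      have "B e (v - \<phi> l) = 0" "\<omega> e' (v - \<phi> l) = 0"
        by (simp_all add: v' expand \<omega>_expand e' y0 ee)
      then have "br (v - \<phi> l) x = 0" for x by (simp add: br_\<omega> split[of "v - \<phi> l"])
      moreover have "B (v - \<phi> l) e' = 0" unfolding v' by (simp add: bilinear_lsub[OF bil, of _ "l3 *\<^sub>R e"] l3_def[symmetric] expand(3) e')
      ultimately have "v - \<phi> l \<in> Z1" by (simp add: Z1_def lie_center_def)
      then show ?thesis by blast
    qed
  qed
  then show "\<exists>\<phi> Z1. central_splitting br H3_bracket \<phi> Z1" by blast
qed

end

section \<open>Derived algebra outside the radical\<close>

text \<open>The isotropic plane spanned by \<open>e\<close> and \<open>f\<close> contains all values of the \<open>J z\<close> for central \<open>z\<close>, and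
  \<open>e', f'\<close> are dual to \<open>e, f\<close>. The central vector \<open>z0\<close> witnesses that not all these \<open>J z\<close> vanish.\<close>

locale null_frame = flat_two_step +
  fixes f e' f' z0 :: 'a
  assumes f_indep: "f \<notin> span {e}" and f_perp: "\<And>z. z \<in> lie_center br \<Longrightarrow> B f z = 0" and ff: "B f f = 0"
    and ee': "B e e' = 1" and fe': "B f e' = 0" and ef': "B e f' = 0" and ff': "B f f' = 1"
    and J_plane: "\<And>z v. z \<in> lie_center br \<Longrightarrow> \<exists>p r. J z v = p *\<^sub>R e + r *\<^sub>R f"
    and z0: "z0 \<in> lie_center br" and nondeg: "\<exists>v w. B (br v w) z0 \<noteq> 0"
begin

definition c :: 'a where "c = br e' f'"
definition ab :: "'a \<Rightarrow> 'a \<Rightarrow> real" where "ab v w = B e v * B f w - B f v * B e w"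
text \<open>The bracket has components along \<open>c\<close> and \<open>e\<close>, with coefficients \<open>ab\<close> and \<open>om\<close>. Pairing it with \<open>e'\<close>
  yields \<open>om\<close> once the contribution of \<open>c\<close> is removed. The endomorphisms \<open>K\<close> and \<open>j\<close> below are the
  metric duals of \<open>ab\<close> and \<open>om\<close>.\<close>

definition om :: "'a \<Rightarrow> 'a \<Rightarrow> real" where "om v w = B (br v w) e' - ab v w * B c e'"
definition K :: "'a \<Rightarrow> 'a" where "K v = B e v *\<^sub>R f - B f v *\<^sub>R e"
definition j :: "'a \<Rightarrow> 'a" where "j v = J e' v - B c e' *\<^sub>R K v"

lemma c_center: "c \<in> lie_center br" unfolding c_def by (rule br_in_center)

lemma ee: "B e e = 0" by (rule e_orth_center[OF e_center])
lemma ef: "B e f = 0" using f_perp[OF e_center] by (simp add: sym[of e f])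
lemma ec: "B e c = 0" by (rule e_orth_center[OF c_center])
lemma fc: "B f c = 0" by (rule f_perp[OF c_center])

lemmas pairings = ee ef sym[of f e, unfolded ef] ff ee' sym[of e' e, unfolded ee'] fe'
  sym[of e' f, unfolded fe'] ef' sym[of f' e, unfolded ef'] ff' sym[of f' f, unfolded ff']
  ec sym[of c e, unfolded ec] fc sym[of c f, unfolded fc]

text \<open>The 2-form on the left vanishes as soon as one argument is orthogonal to \<open>e\<close> and \<open>f\<close>, because \<open>J z\<close>
  has its values in their span; so it is determined by its value on \<open>e'\<close> and \<open>f'\<close>.\<close>

lemma br_center_component:
  assumes z: "z \<in> lie_center br" shows "B (br v w) z = ab v w * B c z"
proof -
  have kr: "B (br v w) z = 0" if "B e w = 0" "B f w = 0" for v w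
  proof -
    obtain p r where "J z v = p *\<^sub>R e + r *\<^sub>R f" using J_plane[OF z] by blast
    then show ?thesis using B_J[of z v w] by (simp add: expand that)
  qed
  have kl: "B (br v w) z = 0" if "B e v = 0" "B f v = 0" for v w
    using kr[OF that, of w] br_skew[of w v] by (simp add: expand)
  let ?v = "B e v *\<^sub>R e' + B f v *\<^sub>R f'" and ?w = "B e w *\<^sub>R e' + B f w *\<^sub>R f'"
  have "B (br (v - ?v) w) z = 0" by (rule kl) (simp_all add: expand pairings)
  moreover have "B (br ?v (w - ?w)) z = 0" by (rule kr) (simp_all add: expand pairings)
  ultimately have "B (br v w) z = B (br ?v ?w) z" by (simp only: expand expand_br)
  also have "br f' e' = - c" unfolding c_def by (rule br_skew)
  then have "B (br ?v ?w) z = ab v w * B c z"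
    by (simp add: expand expand_br ab_def c_def[symmetric] algebra_simps)
  finally show ?thesis .
qed

text \<open>By the previous lemma the difference of \<open>br v w\<close> and its \<open>c\<close>-component is orthogonal to the center, so it
  lies in the radical.\<close>

lemma br_eq: "br v w = ab v w *\<^sub>R c + om v w *\<^sub>R e"
proof -
  have "br v w - ab v w *\<^sub>R c \<in> lie_center br"
    using subspace_diff[OF subspace_center br_in_center subspace_scale[OF subspace_center c_center]] .
  moreover have "B (br v w - ab v w *\<^sub>R c) z = 0" if "z \<in> lie_center br" for z
    by (simp add: expand br_center_component[OF that])
  ultimately obtain r where r: "br v w - ab v w *\<^sub>R c = r *\<^sub>R e" by (rule in_radical)
  then have "B (br v w - ab v w *\<^sub>R c) e' = r" by (simp add: expand pairings)
  then have "om v w = r" by (simp add: om_def expand)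
  with r show ?thesis by (simp add: algebra_simps)
qed

lemma ab_expand: "ab (x + y) w = ab x w + ab y w" "ab w (x + y) = ab w x + ab w y"
    "ab (x - y) w = ab x w - ab y w" "ab w (x - y) = ab w x - ab w y"
    "ab (s *\<^sub>R x) w = s * ab x w" "ab w (s *\<^sub>R x) = s * ab w x" "ab x x = 0"
  by (simp_all add: ab_def expand algebra_simps)

lemma om_expand: "om (x + y) w = om x w + om y w" "om w (x + y) = om w x + om w y"
    "om (x - y) w = om x w - om y w" "om w (x - y) = om w x - om w y"
    "om (s *\<^sub>R x) w = s * om x w" "om w (s *\<^sub>R x) = s * om w x" "om x x = 0"
  by (simp_all add: om_def ab_expand expand expand_br algebra_simps)

lemma om_skew: "om w v = - om v w"
  by (simp add: om_def br_skew[of w v] expand ab_def algebra_simps)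

lemma om_center: "z \<in> lie_center br \<Longrightarrow> om z v = 0" "z \<in> lie_center br \<Longrightarrow> om v z = 0"
  by (simp_all add: om_def ab_def center_br expand e_orth_center f_perp)

lemma B_j: "B (j v) w = om v w"
  by (simp add: j_def expand B_J K_def om_def ab_def)

lemma j_eqI: "(\<And>w. B z w = om v w) \<Longrightarrow> j v = z"
  by (rule eqI) (simp add: B_j)

lemma j_center: "z \<in> lie_center br \<Longrightarrow> j z = 0"
  by (rule j_eqI) (simp add: om_center expand)

lemma j_pairings: "B e (j v) = 0" "B (j v) e = 0" "B c (j v) = 0" "B (j v) c = 0"
    "B (j v) f = om v f" "B f (j v) = om v f"
  using sym[of e "j v"] sym[of c "j v"] sym[of f "j v"]
  by (simp_all add: B_j om_center e_center c_center)

lemma j_add: "j (x + y) = j x + j y" and j_scale: "j (s *\<^sub>R x) = s *\<^sub>R j x"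
  by (rule j_eqI, simp add: expand B_j om_expand)+

lemma Q_eq: "Q u v = ab u v *\<^sub>R c + om u v *\<^sub>R e - B c v *\<^sub>R K u - B e v *\<^sub>R j u - B c u *\<^sub>R K v - B e u *\<^sub>R j v"
proof (rule Q_eqI)
  fix w
  show "B (ab u v *\<^sub>R c + om u v *\<^sub>R e - B c v *\<^sub>R K u - B e v *\<^sub>R j u - B c u *\<^sub>R K v - B e u *\<^sub>R j v) w
      = B (br u v) w + B (br w u) v + B (br w v) u"
    by (simp only: br_eq) (simp add: expand B_j K_def om_skew[of w u] om_skew[of w v] ab_def algebra_simps)
qed

lemma Q_self: "Q e' e' = - (2 * B c e') *\<^sub>R f - 2 *\<^sub>R j e'"
proof -
  have "Q e' e' = - B c e' *\<^sub>R f - B c e' *\<^sub>R f - (j e' + j e')"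
    by (simp add: Q_eq ab_def K_def pairings om_expand)
  also have "\<dots> = - (2 * B c e') *\<^sub>R f - 2 *\<^sub>R j e'"
  proof -
    have "(2 * B c e') *\<^sub>R f = B c e' *\<^sub>R f + B c e' *\<^sub>R f" by (simp only: mult_2 scaleR_left_distrib)
    then show ?thesis by (simp add: scaleR_2)
  qed
  finally show ?thesis .
qed

lemma f_not_center: "f \<notin> lie_center br"
proof
  assume "f \<in> lie_center br"
  then obtain r where "f = r *\<^sub>R e" using f_perp in_radical by metis
  then show False using f_indep by (auto simp: span_singleton)
qed

lemma c_not_multiple: "c \<noteq> p *\<^sub>R e"
proof
  assume "c = p *\<^sub>R e"
  then have "B c z0 = 0" by (simp add: expand e_orth_center[OF z0])
  then show False using nondeg br_center_component[OF z0] by simp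
qed

text \<open>The vector \<open>c\<close> is orthogonal to the maximal isotropic plane, so if its square were not positive it would
  lie in that plane; the central vectors there are the multiples of \<open>e\<close>, but a multiple of \<open>e\<close> cannot
  pair with \<open>z0\<close>.\<close>

lemma c_positive: "B c c > 0"
proof (rule ccontr)
  assume "\<not> B c c > 0"
  then have "B c c \<le> 0" by simp
  then obtain p r where pr: "c = p *\<^sub>R e + r *\<^sub>R f"
    by (rule isotropic_plane_maximal[OF ef ff f_indep ec fc]) (rule that)
  have "r = 0"
  proof (rule ccontr)
    assume "r \<noteq> 0"
    then have "f = (1 / r) *\<^sub>R (c - p *\<^sub>R e)" by (simp add: pr)
    moreover have "(1 / r) *\<^sub>R (c - p *\<^sub>R e) \<in> lie_center br"
      by (intro subspace_scale[OF subspace_center] subspace_diff[OF subspace_center] c_center e_center)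
    ultimately show False using f_not_center by simp
  qed
  then show False using pr c_not_multiple by simp
qed

definition mu :: real where "mu = om f e'"

text \<open>Flatness at the arguments \<open>c, e', e', x\<close>: the left multiplication by \<open>c\<close> is \<open>- \<langle>c, c\<rangle> K\<close>, and the
  factor \<open>\<langle>c, c\<rangle>\<close> cancels.\<close>

lemma om_f: "om f x = mu * B e x"
proof -
  have Kc: "K c = 0" by (simp add: K_def pairings)
  have 1: "Q c e' = - B c c *\<^sub>R f"
    by (simp add: Q_eq ab_def K_def pairings om_center c_center j_center)
  have 2: "Q c x = - B c c *\<^sub>R K x"
    by (simp add: Q_eq ab_def Kc pairings om_center c_center j_center)
  have 3: "Q e' e' = - (2 * B c e') *\<^sub>R f - 2 *\<^sub>R j e'"
    by (rule Q_self)
  have 4: "Q e' x = B f x *\<^sub>R c + om e' x *\<^sub>R e - B c x *\<^sub>R f - B e x *\<^sub>R j e' - B c e' *\<^sub>R K x - j x"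
    by (simp add: Q_eq ab_def K_def pairings)
  have "2 * B (br x e') (br c e') = B (Q c e') (Q e' x) - B (Q e' e') (Q c x)" by (rule flat_eq)
  then have "B c c = 0 \<or> B e x * om e' f = om x f"
    unfolding 1 2 3 4
    by (simp add: center_br[OF c_center] expand pairings j_pairings K_def algebra_simps)
  then have "om x f = B e x * om e' f" using c_positive by simp
  then show ?thesis unfolding mu_def by (simp add: om_skew[of f])
qed

lemma mu_nonzero: "mu \<noteq> 0"
proof
  assume "mu = 0"
  then have "br f x = 0" for x by (simp add: br_eq om_f ab_def pairings)
  then show False using f_not_center by (simp add: lie_center_def)
qed

lemma om_f': "om x f = - mu * B e x" using om_skew[of x f] by (simp add: om_f)

lemma j_f: "j f = mu *\<^sub>R e"
  by (rule j_eqI) (simp add: expand om_f)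

text \<open>Flatness at the arguments \<open>u, e', e', x\<close>: all terms except \<open>\<langle>j u, j x\<rangle>\<close> pair vectors of the isotropic
  plane with each other, pair \<open>e\<close> with values of \<open>j\<close>, or are values of \<open>om\<close> between \<open>f\<close> and one of
  \<open>u\<close>, \<open>x\<close>, which are zero by \<open>om_f\<close>.\<close>

lemma j_isotropic:
  assumes u: "B e u = 0" "B f u = 0" and x: "B e x = 0" "B f x = 0"
  shows "B (j u) (j x) = 0"
proof -
  have 1: "Q u e' = om u e' *\<^sub>R e - j u - B c u *\<^sub>R f"
    by (simp add: Q_eq ab_def K_def pairings u)
  have 2: "Q e' x = om e' x *\<^sub>R e - B c x *\<^sub>R f - j x"
    by (simp add: Q_eq ab_def K_def pairings x)
  have 3: "Q e' e' = - (2 * B c e') *\<^sub>R f - 2 *\<^sub>R j e'"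
    by (rule Q_self)
  have 4: "Q u x = om u x *\<^sub>R e" by (simp add: Q_eq ab_def K_def u x)
  have "2 * B (br x e') (br u e') = B (Q u e') (Q e' x) - B (Q e' e') (Q u x)" by (rule flat_eq)
  then show ?thesis unfolding 1 2 3 4
    by (simp only: br_eq) (simp add: expand pairings j_pairings ab_def u x om_f')
qed

text \<open>Flatness at the arguments \<open>e', f', e', f'\<close>. The curvature side contributes \<open>- 2 \<langle>c, c\<rangle>\<close>, and the product
  side \<open>\<langle>c, c\<rangle> - \<langle>j f', j f'\<rangle>\<close>.\<close>

lemma j_norm: "B (j f') (j f') = 3 * B c c"
proof -
  have 1: "Q e' e' = - (2 * B c e') *\<^sub>R f - 2 *\<^sub>R j e'"
    by (rule Q_self)
  have 2: "Q f' f' = B c f' *\<^sub>R e + B c f' *\<^sub>R e"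
    by (simp add: Q_eq ab_def K_def pairings om_expand)
  have 3: "Q f' e' = - c + om f' e' *\<^sub>R e + B c e' *\<^sub>R e - j f' - B c f' *\<^sub>R f"
    by (simp add: Q_eq ab_def K_def pairings)
  have 4: "Q e' f' = c + om e' f' *\<^sub>R e - B c f' *\<^sub>R f + B c e' *\<^sub>R e - j f'"
    by (simp add: Q_eq ab_def K_def pairings)
  have 5: "br f' e' = - c + om f' e' *\<^sub>R e" "br e' f' = c + om e' f' *\<^sub>R e"
    by (simp_all add: br_eq ab_def pairings)
  have "2 * B (br f' e') (br e' f') = B (Q e' e') (Q f' f') - B (Q f' e') (Q e' f')" by (rule flat_eq)
  then show ?thesis unfolding 1 2 3 4 5
    by (simp add: expand pairings j_pairings om_f')
qed

lemma j_plane: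
  assumes u: "B e u = 0" "B f u = 0"
  obtains p r where "j u = p *\<^sub>R e + r *\<^sub>R f"
proof -
  have "B e (j u) = 0" "B f (j u) = 0" "B (j u) (j u) \<le> 0"
    by (simp_all add: j_pairings j_isotropic u om_f')
  then show thesis by (rule isotropic_plane_maximal[OF ef ff f_indep]) (rule that)
qed

end

context flat_two_step
begin

text \<open>Two steps of Gram-Schmidt elimination, with non-degeneracy supplying the initial vectors.\<close>

lemma dual_frame:
  assumes f: "f \<notin> span {e}" and ef: "B e f = 0"
  obtains e' f' where "B e e' = 1" "B f e' = 0" "B e f' = 0" "B f f' = 1"
proof -
  obtain e0 where e0: "B e e0 = 1" by (rule dual_vector)
  define g where "g = f - B f e0 *\<^sub>R e"
  have "g \<noteq> 0" using f by (auto simp: g_def span_singleton)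
  moreover have "(\<forall>y. B g y = 0) \<longrightarrow> g = 0" using pseudo unfolding pseudo_euclidean_metric_def by blast
  ultimately obtain y0 where y0: "B g y0 \<noteq> 0" by blast
  define y where "y = (1 / B g y0) *\<^sub>R y0"
  have "B g y = 1" using y0 by (simp add: y_def expand)
  then have gy: "B f y - B f e0 * B e y = 1" by (simp add: g_def expand)
  define f' where "f' = y - B e y *\<^sub>R e0"
  define e' where "e' = e0 - B f e0 *\<^sub>R f'"
  have 1: "B e f' = 0" by (simp add: f'_def expand e0)
  have 2: "B f f' = 1" using gy by (simp add: f'_def expand mult.commute)
  show thesis by (rule that[of e' f']) (simp_all add: e'_def expand e0 1 2)
qed

text \<open>Take \<open>f\<close> to be a value of \<open>J z0\<close> outside the line of \<open>e\<close>. Such a value exists: if \<open>J z0\<close> had values in that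
  line, the 2-form it represents would be \<open>r(v) \<langle>e, w\<rangle>\<close>, and such a product is alternating only if
  it is zero. The images of all other \<open>J z\<close> are isotropic and orthogonal to \<open>e\<close> and \<open>f\<close>, so they lie in the
  plane.\<close>

lemma null_frame_exists:
  assumes z0: "z0 \<in> lie_center br" and nd: "B (br v0 w0) z0 \<noteq> 0"
  obtains f e' f' where "null_frame br B e f e' f' z0"
proof -
  obtain e0 where e0: "B e e0 = 1" by (rule dual_vector)
  have "\<exists>u. J z0 u \<notin> span {e}"
  proof (rule ccontr)
    assume "\<not> ?thesis"
    then have "\<forall>u. \<exists>r. J z0 u = r *\<^sub>R e" by (auto simp: span_singleton)
    then obtain r where r: "\<And>u. J z0 u = r u *\<^sub>R e" by metis
    have B: "B (br v w) z0 = r v * B e w" for v w using B_J[of z0 v w] by (simp add: r expand)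
    have "r e0 = 0" using B[of e0 e0] by (simp add: e0 expand)
    then have "B (br e0 v) z0 = 0" for v using B[of e0 v] by simp
    then have "B (br v e0) z0 = 0" for v using br_skew[of v e0] by (simp add: expand)
    then have "r v = 0" for v using B[of v e0] e0 by simp
    then show False using nd B by simp
  qed
  then obtain u where u: "J z0 u \<notin> span {e}" by blast
  define f where "f = J z0 u"
  have f_perp: "B f z = 0" if "z \<in> lie_center br" for z
    by (simp add: f_def B_J center_br[OF that] expand)
  have J_perp: "B e (J z v) = 0" if "z \<in> lie_center br" for z v
    using sym[of e "J z v"] by (simp add: B_J center_br[OF e_center] expand)
  have ef: "B e f = 0" unfolding f_def by (rule J_perp[OF z0])
  have iso: "B f (J z v) = 0" if "z \<in> lie_center br" for z v
    unfolding f_def by (rule central_J_isotropic[OF that z0])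
  have ff: "B f f = 0" using iso[OF z0, of u] by (simp add: f_def)
  have f_indep: "f \<notin> span {e}" using u by (simp add: f_def)
  obtain e' f' where d: "B e e' = 1" "B f e' = 0" "B e f' = 0" "B f f' = 1"
    by (rule dual_frame[OF f_indep ef])
  have "null_frame br B e f e' f' z0"
  proof (unfold_locales)
    fix z v assume z: "z \<in> lie_center br"
    have "B (J z v) (J z v) \<le> 0" by (simp add: central_J_isotropic[OF z z])
    then obtain p r where "J z v = p *\<^sub>R e + r *\<^sub>R f"
      by (rule isotropic_plane_maximal[OF ef ff f_indep J_perp[OF z] iso[OF z]])
    then show "\<exists>p r. J z v = p *\<^sub>R e + r *\<^sub>R f" by blast
  next
    show "\<exists>v w. B (br v w) z0 \<noteq> 0" using nd by blast
  qed (rule f_indep f_perp ff d z0; assumption?)+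
  then show thesis by (rule that)
qed

end

section \<open>The normal form\<close>

definition frame_map :: "('n::finite \<Rightarrow> 'a::real_vector) \<Rightarrow> real^'n \<Rightarrow> 'a" where
  "frame_map x l = (\<Sum>i\<in>UNIV. l $ i *\<^sub>R x i)"

lemma linear_frame_map: "linear (frame_map x)"
  by (rule linearI) (simp_all add: frame_map_def sum.distrib scaleR_left_distrib scaleR_right.sum)

lemma frame_map_axis: "frame_map x (axis i 1) = x i"
proof -
  have "frame_map x (axis i 1) = (\<Sum>k\<in>UNIV. if k = i then x k else 0)"
    unfolding frame_map_def by (rule sum.cong) (auto simp: axis_def)
  then show ?thesis by simp
qed

lemma range_frame_map: "range (frame_map x) = span (range x)"
proof
  show "range (frame_map x) \<subseteq> span (range x)"
    unfolding frame_map_def by (intro image_subsetI span_sum span_scale span_base rangeI)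
  show "span (range x) \<subseteq> range (frame_map x)"
  proof (rule span_minimal)
    show "range x \<subseteq> range (frame_map x)" using frame_map_axis[of x] by (metis image_subsetI rangeI)
    show "subspace (range (frame_map x))" by (rule linear_subspace_image[OF linear_frame_map subspace_UNIV])
  qed
qed

lemma inj_frame_map_independent:
  assumes inj: "inj (frame_map x)"
  shows "inj x" "independent (range x)"
proof -
  show ix: "inj x"
  proof (rule injI)
    fix i k assume "x i = x k"
    then have "frame_map x (axis i 1) = frame_map x (axis k 1)" by (simp add: frame_map_axis)
    then have "axis i (1::real) = axis k 1" using inj by (simp add: inj_eq)
    then show "i = k" by (simp add: axis_eq_axis)
  qed
  show "independent (range x)"
  proof
    assume "dependent (range x)"
    then obtain u w where w: "w \<in> range x" "u w \<noteq> 0" and s: "(\<Sum>v\<in>range x. u v *\<^sub>R v) = 0"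
      using dependent_finite[of "range x"] by auto
    have "frame_map x (\<chi> i. u (x i)) = frame_map x 0"
      using s by (simp add: frame_map_def sum.reindex[OF ix])
    then have "(\<chi> i. u (x i)) = 0" using inj by (simp only: inj_eq)
    then show False using w by (auto simp: vec_eq_iff)
  qed
qed

lemma L64_basis_bracket:
  assumes lie: "lie_algebra br" and x: "L64_basis br L x"
  shows "br (frame_map x u) (frame_map x v) = frame_map x (L64_bracket u v)"
proof -
  have bl: "bilinear br" and self: "\<And>y. br y y = 0" using lie by (auto simp: lie_algebra_def)
  have skew: "br z y = - br y z" for y z
  proof -
    have "br (y + z) (y + z) = br y y + br y z + (br z y + br z z)"
      by (simp only: bilinear_ladd[OF bl] bilinear_radd[OF bl] add_ac)
    then have "br z y + br y z = 0" by (simp add: self add.commute)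
    then show ?thesis by (simp add: eq_neg_iff_add_eq_0)
  qed
  have 1: "br (x 1) (x 2) = x 5" "br (x 1) (x 3) = x 6" "br (x 2) (x 4) = x 6"
    using x by (auto simp: L64_basis_def)
  have 2: "br (x 2) (x 1) = - x 5" "br (x 3) (x 1) = - x 6" "br (x 4) (x 2) = - x 6"
    using skew 1 by metis+
  have "\<forall>i j. (i, j) \<notin> {(1, 2), (2, 1), (1, 3), (3, 1), (2, 4), (4, 2)} \<longrightarrow> br (x i) (x j) = 0"
    using x unfolding L64_basis_def by blast
  then have 3: "br (x i) (x j) = 0" if "(i, j) \<notin> {(1, 2), (2, 1), (1, 3), (3, 1), (2, 4), (4, 2)}" for i j
    using that by blast
  have l: "br (frame_map x u) w = (\<Sum>i\<in>UNIV. u $ i *\<^sub>R br (x i) w)" for w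
  proof -
    have "linear (\<lambda>y. br y w)" using bl by (simp add: bilinear_def)
    from linear_sum[OF this, of "\<lambda>i. u $ i *\<^sub>R x i" UNIV] show ?thesis
      by (simp add: frame_map_def bilinear_lmul[OF bl])
  qed
  have r: "br w (frame_map x v) = (\<Sum>j\<in>UNIV. v $ j *\<^sub>R br w (x j))" for w
  proof -
    have "linear (br w)" using bl by (simp add: bilinear_def)
    from linear_sum[OF this, of "\<lambda>i. v $ i *\<^sub>R x i" UNIV] show ?thesis
      by (simp add: frame_map_def bilinear_rmul[OF bl])
  qed
  have "br (frame_map x u) (frame_map x v) = (\<Sum>i\<in>UNIV. \<Sum>j\<in>UNIV. (u $ i * v $ j) *\<^sub>R br (x i) (x j))"
    unfolding l[of "frame_map x v"] by (simp only: r scaleR_right.sum scaleR_scaleR)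
  also have "\<dots> = frame_map x (L64_bracket u v)"
    by (simp add: sum_6 1 2 3 frame_map_def algebra_simps)
  finally show ?thesis .
qed

context null_frame
begin

text \<open>The brackets already have the right shape on \<open>e', f', f, j f', c, e\<close> up to scaling and up to the value
  \<open>om e' (j f')\<close>. The vector \<open>f'\<close> is first made orthogonal to \<open>c\<close> (by a multiple of \<open>c\<close>) and isotropic
  (by a multiple of \<open>f\<close>), giving \<open>x2\<close> and \<open>h = j x2\<close>. The vector \<open>e'\<close> is corrected by a multiple of \<open>x2\<close> to
  make \<open>om e1 h\<close> vanish, which forces the compensating change of \<open>f\<close> to \<open>f2\<close>, and then made orthogonal to
  \<open>h\<close>, to \<open>x2\<close> and to itself by multiples of \<open>h\<close>, \<open>f2\<close> and \<open>e\<close>; each correction preserves the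
  preceding normalizations.\<close>

lemma normal_form:
  "\<exists>x Z1 a b c d. L64_basis br (span (range x)) x \<and> central_splitting br L64_bracket (frame_map x) Z1 \<and>
     b \<noteq> 0 \<and> d > 0 \<and> (\<forall>i j. B (x i) (x j) = metric0 a b c d $ i $ j)"
proof -
  define C where "C = B c c"
  have C: "C > 0" unfolding C_def by (rule c_positive)
  define f1 where "f1 = f' - (B f' c / C) *\<^sub>R c"
  define x2 where "x2 = f1 - (B f1 f1 / 2) *\<^sub>R f"
  have f1: "B f f1 = 1" "B f1 f = 1" "B e f1 = 0" "B f1 e = 0" "B f1 c = 0" "B c f1 = 0"
    using C by (simp_all add: f1_def expand pairings sym[of c f'] C_def[symmetric])
  have x2: "B f x2 = 1" "B x2 f = 1" "B e x2 = 0" "B x2 e = 0" "B x2 c = 0" "B c x2 = 0" "B x2 x2 = 0"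
    by (simp_all add: x2_def expand pairings f1)
  define h where "h = j x2"
  have h_om: "B h w = om x2 w" "B w h = om x2 w" for w by (simp_all add: h_def B_j sym[of w])
  have hh: "B h h = 3 * C"
  proof -
    have "j x2 = j f' - (B f1 f1 / 2 * mu) *\<^sub>R e"
      unfolding x2_def f1_def diff_conv_add_uminus j_add scaleR_minus_left[symmetric] j_scale j_f
      by (simp add: j_center c_center)
    then show ?thesis by (simp add: h_def expand j_norm j_pairings pairings C_def)
  qed
  have h: "B h e = 0" "B e h = 0" "B h f = 0" "B f h = 0" "B h c = 0" "B c h = 0"
    by (simp_all add: h_def j_pairings om_f' x2)
  have h': "B x2 h = 0" "B h x2 = 0" by (simp_all add: h_om om_expand)
  have om_h: "om x2 h = 3 * C" "om h x2 = - (3 * C)" "om f h = 0" "om h f = 0" "om h h = 0" "om x2 f = 0" "om f x2 = 0"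
    using h_om(1)[of h] hh by (simp_all add: om_skew[of h x2] om_f om_f' h x2 om_expand)
  note om_e = om_center[OF e_center]
  define r where "r = om e' h / (3 * C)"
  define e1 where "e1 = e' - r *\<^sub>R x2"
  define e2 where "e2 = e1 - (B e1 h / (3 * C)) *\<^sub>R h"
  define f2 where "f2 = f + r *\<^sub>R e"
  define e3 where "e3 = e2 - B e2 x2 *\<^sub>R f2"
  define x1 where "x1 = e3 - (B e3 e3 / 2) *\<^sub>R e"
  have e1: "B e e1 = 1" "B e1 e = 1" "B f e1 = - r" "B e1 f = - r" "om e1 h = 0"
    using C by (simp_all add: e1_def expand pairings x2 om_expand om_h r_def)
  have e2: "B e e2 = 1" "B e2 e = 1" "B f e2 = - r" "B e2 f = - r" "B e2 h = 0" "om e2 h = 0"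
    using C by (simp_all add: e2_def expand e1 h hh om_expand om_h)
  have f2: "B e f2 = 0" "B f2 e = 0" "B f f2 = 0" "B f2 f = 0" "B f2 f2 = 0" "B f2 x2 = 1" "B x2 f2 = 1"
    "B f2 h = 0" "B h f2 = 0" "B f2 e2 = 0" "B e2 f2 = 0" "om f2 h = 0" "B f2 c = 0" "B c f2 = 0"
    by (simp_all add: f2_def expand pairings x2 h e2 om_expand om_h om_e)
  have e3: "B e e3 = 1" "B e3 e = 1" "B f e3 = - r" "B e3 f = - r" "B e3 h = 0" "om e3 h = 0"
    "B e3 x2 = 0" "B e3 f2 = 0"
    by (simp_all add: e3_def expand e2 f2 om_expand)
  have x1: "B e x1 = 1" "B x1 e = 1" "B f x1 = - r" "B x1 f = - r" "B x1 h = 0" "om x1 h = 0"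
    "B x1 x2 = 0" "B x1 f2 = 0" "B x1 x1 = 0"
    by (simp_all add: x1_def expand e3 pairings f2 x2 h om_expand om_e)
  have x1': "B h x1 = 0" "B x2 x1 = 0" "B f2 x1 = 0" "om h x1 = 0"
    by (simp_all add: sym[of h x1] sym[of x2 x1] sym[of f2 x1] om_skew[of h x1] x1)
  define p where "p = om x1 x2"
  \<comment> \<open>The scalings of \<open>f2\<close> and \<open>h\<close> are dictated by \<open>br x1 x3 = e\<close> and \<open>br x2 x4 = e\<close>.\<close>
  define s where "s = - 1 / mu"
  have s: "s \<noteq> 0" "s * mu = - 1" "mu * s = - 1" using mu_nonzero by (simp_all add: s_def)
  define x3 where "x3 = s *\<^sub>R f2"
  define x4 where "x4 = (1 / (3 * C)) *\<^sub>R h"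
  define x5 where "x5 = c + p *\<^sub>R e"
  have x5_center: "x5 \<in> lie_center br"
    unfolding x5_def by (intro subspace_add[OF subspace_center] subspace_scale[OF subspace_center] c_center e_center)
  note om_x5 = om_center[OF x5_center]
  have om_x3: "om x1 x3 = 1" "om x2 x3 = 0" "om x3 x1 = - 1" "om x3 x2 = 0"
    using s by (simp_all add: x3_def f2_def om_expand om_e om_h om_f om_f' x1 x2)
  have om_x4: "om x1 x4 = 0" "om x2 x4 = 1" "om x4 x1 = 0" "om x4 x2 = - 1" "om x3 x4 = 0" "om x4 x3 = 0"
    using C by (simp_all add: x4_def x3_def f2_def om_expand om_e om_h x1 x1')
  have planes: "B e x3 = 0" "B f x3 = 0" "B e x4 = 0" "B f x4 = 0" "B e x5 = 0" "B f x5 = 0"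
    by (simp_all add: x3_def x4_def x5_def expand f2 h pairings)
  have brs: "br x1 x2 = x5" "br x1 x3 = e" "br x2 x4 = e" "br x2 x1 = - x5" "br x3 x1 = - e" "br x4 x2 = - e"
    "br x1 x4 = 0" "br x4 x1 = 0" "br x2 x3 = 0" "br x3 x2 = 0" "br x3 x4 = 0" "br x4 x3 = 0"
    by (simp_all add: br_eq[of x1] br_eq[of x2] br_eq[of x3] br_eq[of x4] ab_def planes x1 x2 om_x3 om_x4
        x5_def p_def om_skew[of x2 x1])
  define x where "x i = (vector [x1, x2, x3, x4, x5, e] :: 'a^6) $ i" for i :: 6
  have x: "x 1 = x1" "x 2 = x2" "x 3 = x3" "x 4 = x4" "x 5 = x5" "x 6 = e"
    by (simp_all add: x_def)
  have frame: "frame_map x l = l$1 *\<^sub>R x1 + l$2 *\<^sub>R x2 + l$3 *\<^sub>R x3 + l$4 *\<^sub>R x4 + l$5 *\<^sub>R x5 + l$6 *\<^sub>R e" for l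
    by (simp add: frame_map_def sum_6 x)
  have gram: "\<forall>i k. B (x i) (x k) = metric0 (B x1 c + p) s (B x2 x4) (1 / (3 * C)) $ i $ k"
    using C unfolding forall_6 metric0_def x vector_6
    by (simp add: x3_def x4_def x5_def expand pairings f2 h h' hh x1 x1' x2 sym[of c x1] C_def[symmetric])
  define Z1 where "Z1 = {z \<in> lie_center br. B z x1 = 0 \<and> B z x5 = 0}"
  have subZ: "subspace Z1" using subspace_center unfolding Z1_def subspace_def by (simp add: expand)
  have B5: "B x5 x5 = C" "B e x5 = 0"
    by (simp_all add: x5_def expand pairings C_def)
  \<comment> \<open>A central vector is orthogonal to \<open>e\<close> and \<open>f\<close> and is killed by \<open>om x1\<close> and \<open>om x2\<close>, which removes the
    first four coordinates; the conditions defining \<open>Z1\<close> remove the last two.\<close>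
  have ker: "l = 0" if "frame_map x l \<in> Z1" for l
  proof -
    have cen: "frame_map x l \<in> lie_center br" and o: "B (frame_map x l) x1 = 0" "B (frame_map x l) x5 = 0"
      using that by (auto simp: Z1_def)
    have 1: "l$1 = 0" using e_orth_center[OF cen] by (simp add: frame expand x1 x2 planes ee)
    have 2: "l$2 = 0" using f_perp[OF cen] by (simp add: frame expand x1 x2 planes pairings 1)
    have 3: "l$3 = 0" using om_center(2)[OF cen, of x1] by (simp add: frame om_expand 1 2 om_x3 om_x4 om_x5 om_e)
    have 4: "l$4 = 0" using om_center(2)[OF cen, of x2] by (simp add: frame om_expand 1 2 om_x3 om_x4 om_x5 om_e)
    have 5: "l$5 = 0" using o(2) C by (simp add: frame expand 1 2 3 4 B5)
    have "l$6 = 0" using o(1) by (simp add: frame expand 1 2 3 4 5 x1)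
    with 1 2 3 4 5 show ?thesis by (simp add: vec_eq_iff forall_6)
  qed
  have inj: "inj (frame_map x)"
    unfolding linear_injective_0[OF linear_frame_map] using ker subspace_0[OF subZ] by metis
  have basis: "L64_basis br (span (range x)) x"
  proof -
    have "br (x i) (x k) = 0" if "(i, k) \<notin> {(1, 2), (2, 1), (1, 3), (3, 1), (2, 4), (4, 2)}" for i k
    proof -
      have "\<forall>i k. (i, k) \<notin> {(1, 2), (2, 1), (1, 3), (3, 1), (2, 4), (4, 2)} \<longrightarrow> br (x i) (x k) = 0"
        unfolding forall_6 x by (simp add: brs center_br[OF x5_center] center_br[OF e_center])
      then show ?thesis using that by blast
    qed
    then show ?thesis
      unfolding L64_basis_def x using inj_frame_map_independent[OF inj] by (simp add: brs)
  qed
  have "central_splitting br L64_bracket (frame_map x) Z1"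
  proof (rule central_splittingI)
    show "linear (frame_map x)" by (rule linear_frame_map)
    show "br (frame_map x u) (frame_map x v) = frame_map x (L64_bracket u v)" for u v
      by (rule L64_basis_bracket[OF lie basis])
    show "subspace Z1" by (rule subZ)
    show "l = 0" if "frame_map x l \<in> Z1" for l by (rule ker[OF that])
    show "Z1 \<subseteq> lie_center br" by (auto simp: Z1_def)
    show "\<exists>l. v - frame_map x l \<in> Z1" for v
    proof -
      \<comment> \<open>After the first two subtractions the vector is orthogonal to the isotropic plane, so \<open>j\<close> maps it into
        that plane, and the next two kill this image; the vector is then central, and the last two
        subtractions move it into \<open>Z1\<close>.\<close>
      define v1 where "v1 = v - B e v *\<^sub>R x1 - B f2 v *\<^sub>R x2"
      define v2 where "v2 = v1 - om x1 v1 *\<^sub>R x3 - om x2 v1 *\<^sub>R x4"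
      define v3 where "v3 = v2 - (B v2 x5 / C) *\<^sub>R x5"
      define v4 where "v4 = v3 - B v3 x1 *\<^sub>R e"
      define l :: "real^6" where
        "l = vector [B e v, B f2 v, om x1 v1, om x2 v1, B v2 x5 / C, B v3 x1]"
      have v4: "v4 = v - frame_map x l"
        by (simp add: v4_def v3_def v2_def v1_def frame l_def)
      have f_f2: "B f w = B f2 w - r * B e w" for w by (simp add: f2_def expand)
      have v1: "B e v1 = 0" "B f v1 = 0"
        by (simp_all add: v1_def f_f2 expand x1 x1' x2 f2)
      then have v2: "B e v2 = 0" "B f v2 = 0" "om x1 v2 = 0" "om x2 v2 = 0"
        by (simp_all add: v2_def expand planes om_expand om_x3 om_x4)
      then have "B e v4 = 0" "B f v4 = 0" and om4: "om x1 v4 = 0" "om x2 v4 = 0"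
        by (simp_all add: v4_def v3_def expand planes pairings om_expand om_x5 om_e)
      then obtain q t where st: "j v4 = q *\<^sub>R e + t *\<^sub>R f" using j_plane by blast
      have "om v4 x1 = q - r * t" "om v4 x2 = t"
        using B_j[of v4 x1] B_j[of v4 x2] by (simp_all add: st expand x1 x2 mult.commute)
      then have "t = 0" "q = 0" using om4 om_skew[of v4 x1] om_skew[of v4 x2] by simp_all
      then have "j v4 = 0" by (simp add: st)
      then have "om v4 w = 0" for w using B_j[of v4 w] by (simp add: expand)
      then have "br v4 w = 0" for w
        using \<open>B e v4 = 0\<close> \<open>B f v4 = 0\<close> by (simp add: br_eq[of v4] ab_def)
      moreover have "B v4 x5 = 0" "B v4 x1 = 0"
        using C by (simp_all add: v4_def expand B5 x1) (simp add: v3_def expand B5)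
      ultimately have "v4 \<in> Z1" by (simp add: Z1_def lie_center_def)
      then show ?thesis using v4 by blast
    qed
  qed
  then show ?thesis using basis gram s(1) C
    by (intro exI[of _ x] exI[of _ Z1] exI[of _ "B x1 c + p"] exI[of _ s] exI[of _ "B x2 x4"]
        exI[of _ "1 / (3 * C)"]) simp
qed

end

section \<open>The classification\<close>

lemma flat_two_step_exists:
  assumes "lie_algebra br" "two_step_nilpotent br" and ad: "admissible_metric br B"
  obtains e where "flat_two_step br B e"
proof -
  let ?R = "lie_center br \<inter> metric_orthogonal B (lie_center br)"
  have pm: "pseudo_euclidean_metric B" "flat_metric br B" "has_signature B 2 (DIM('a) - 2)" "dim ?R = 1"
    using ad by (auto simp: admissible_metric_def)
  have bl: "bilinear br" "bilinear B"
    using assms(1) pm(1) by (auto simp: lie_algebra_def pseudo_euclidean_metric_def)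
  have "subspace ?R"
    by (simp add: subspace_def lie_center_def metric_orthogonal_def bilinear_ladd[OF bl(1)] bilinear_ladd[OF bl(2)]
        bilinear_lmul[OF bl(1)] bilinear_lmul[OF bl(2)] bilinear_lzero[OF bl(1)] bilinear_lzero[OF bl(2)])
  moreover obtain E where E: "E \<subseteq> ?R" "independent E" "?R \<subseteq> span E" "card E = 1"
    using basis_exists[of ?R] pm(4) by metis
  obtain e where e: "E = {e}" using E(4) by (auto simp: card_1_singleton_iff)
  ultimately have "?R = span {e}" using E span_minimal by blast
  moreover have "e \<noteq> 0" using E(2) e dependent_zero by blast
  ultimately show thesis using assms pm by (intro that[of e]) (simp add: flat_two_step_def)
qed

text \<open>The two cases are whether the brackets are orthogonal to the whole center.\<close>

lemma admissible_metric_dichotomy: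
  fixes br :: "'a::euclidean_space \<Rightarrow> 'a \<Rightarrow> 'a"
  assumes "lie_algebra br" "two_step_nilpotent br" "admissible_metric br B"
  obtains (degenerate) \<phi> Z1 e where "central_splitting br H3_bracket \<phi> Z1" "\<And>v w. \<exists>r. br v w = r *\<^sub>R e"
  | (nondegenerate) x Z1 a b c d where "L64_basis br (span (range x)) x"
      "central_splitting br L64_bracket (frame_map x) Z1"
      "b \<noteq> 0" "d > 0" "\<And>i j. B (x i) (x j) = metric0 a b c d $ i $ j"
proof -
  obtain e where "flat_two_step br B e" using flat_two_step_exists[OF assms] .
  then interpret flat_two_step br B e .
  show thesis
  proof (cases "\<forall>z\<in>lie_center br. \<forall>v w. B (br v w) z = 0")
    case True
    then have "\<exists>\<phi> Z1. central_splitting br H3_bracket \<phi> Z1" "\<And>v w. \<exists>r. br v w = r *\<^sub>R e"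
      using degenerate_derived_algebra by blast+
    then show thesis using degenerate by blast
  next
    case False
    then obtain z0 v0 w0 where "z0 \<in> lie_center br" "B (br v0 w0) z0 \<noteq> 0" by blast
    then obtain f e' f' where "null_frame br B e f e' f' z0" by (rule null_frame_exists)
    then interpret null_frame br B e f e' f' z0 .
    from normal_form show thesis by (elim exE conjE) (rule nondegenerate, auto)
  qed
qed

text \<open>The derived algebra contains the independent vectors \<open>x\<^sub>5\<close> and \<open>x\<^sub>6\<close>.\<close>

lemma L64_derived_algebra_not_line:
  assumes cs: "central_splitting br L64_bracket \<phi> Z1" and line: "\<And>v w. \<exists>r. br v w = r *\<^sub>R e"
  shows False
proof -
  have lin: "linear \<phi>" and inj: "inj \<phi>" and hom: "\<And>u v. br (\<phi> u) (\<phi> v) = \<phi> (L64_bracket u v)"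
    using cs by (auto simp: central_splitting_def)
  have b: "L64_bracket (axis 1 1) (axis 2 1) = axis 5 1" "L64_bracket (axis 1 1) (axis 3 1) = axis 6 1"
    by (simp_all add: vec_eq_iff forall_6 axis_def)
  obtain r s where r: "\<phi> (axis 5 1) = r *\<^sub>R e" and s: "\<phi> (axis 6 1) = s *\<^sub>R e"
    using line hom b by metis
  have "\<phi> (s *\<^sub>R axis 5 1 - r *\<^sub>R axis 6 1) = 0"
    by (simp add: linear_diff[OF lin] linear_cmul[OF lin] r s mult.commute)
  then have "s *\<^sub>R axis 5 1 - r *\<^sub>R axis 6 1 = (0 :: real^6)"
    using inj linear_injective_0[OF lin] by blast
  then have "(s *\<^sub>R axis 5 1 - r *\<^sub>R axis 6 1 :: real^6) $ 5 = 0" "(s *\<^sub>R axis 5 1 - r *\<^sub>R axis 6 1 :: real^6) $ 6 = 0"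
    by simp_all
  then have "r = 0" by (simp add: axis_def)
  then have "\<phi> (axis 5 1) = 0" by (simp add: r)
  then have "axis 5 1 = (0 :: real^6)" using inj linear_injective_0[OF lin] by blast
  then show False by (simp add: axis_eq_0_iff)
qed

theorem theorem6p1:
  fixes br :: "'a::euclidean_space \<Rightarrow> 'a \<Rightarrow> 'a" and n :: nat
  assumes "lie_algebra br" and "two_step_nilpotent br" and "DIM('a) = n"
  shows "((\<exists>B. pseudo_euclidean_metric B \<and> flat_metric br B \<and> has_signature B 2 (n - 2) \<and>
             dim (lie_center br \<inter> metric_orthogonal B (lie_center br)) = 1) \<longleftrightarrow>
           trivial_extension br H3_bracket \<or> trivial_extension br L64_bracket) \<and>
         (trivial_extension br L64_bracket \<longrightarrow>
           (\<forall>B. pseudo_euclidean_metric B \<and> flat_metric br B \<and> has_signature B 2 (n - 2) \<and>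
                dim (lie_center br \<inter> metric_orthogonal B (lie_center br)) = 1 \<longrightarrow>
             (\<exists>Z1 L x a b c d.
                subspace Z1 \<and> Z1 \<subseteq> lie_center br \<and> lie_subalgebra br L \<and>
                Z1 \<inter> L = {0} \<and> {z + l | z l. z \<in> Z1 \<and> l \<in> L} = UNIV \<and>
                L64_basis br L x \<and> b \<noteq> 0 \<and> d > 0 \<and>
                (\<forall>i j. B (x i) (x j) = metric0 a b c d $ i $ j))))"
proof -
  note triv = trivial_extension_iff_central_splitting[OF assms(1)]
  have adm: "pseudo_euclidean_metric B \<and> flat_metric br B \<and> has_signature B 2 (n - 2) \<and>
      dim (lie_center br \<inter> metric_orthogonal B (lie_center br)) = 1 \<longleftrightarrow> admissible_metric br B" for B
    unfolding admissible_metric_def assms(3) ..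
  have existence: "(\<exists>B. admissible_metric br B) \<longleftrightarrow>
      trivial_extension br H3_bracket \<or> trivial_extension br L64_bracket"
  proof
    assume "\<exists>B. admissible_metric br B"
    then obtain B where B: "admissible_metric br B" ..
    show "trivial_extension br H3_bracket \<or> trivial_extension br L64_bracket"
      by (rule admissible_metric_dichotomy[OF assms(1,2) B]) (unfold triv, blast+)
  next
    assume "trivial_extension br H3_bracket \<or> trivial_extension br L64_bracket"
    then show "\<exists>B. admissible_metric br B"
    proof
      assume "trivial_extension br H3_bracket"
      then obtain \<phi> Z1 where "central_splitting br H3_bracket \<phi> Z1" unfolding triv by blast
      from admissible_metric_central_extension[OF assms(1) this bilinear_H3_bracket admissible_H3_metric]
      show ?thesis by simp
    next
      assume "trivial_extension br L64_bracket"
      then obtain \<phi> Z1 where "central_splitting br L64_bracket \<phi> Z1" unfolding triv by blast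
      from admissible_metric_central_extension[OF assms(1) this bilinear_L64_bracket admissible_L64_metric]
      show ?thesis by simp
    qed
  qed
  have normal_form: "\<exists>Z1 L x a b c d. subspace Z1 \<and> Z1 \<subseteq> lie_center br \<and> lie_subalgebra br L \<and>
      Z1 \<inter> L = {0} \<and> {z + l | z l. z \<in> Z1 \<and> l \<in> L} = UNIV \<and>
      L64_basis br L x \<and> b \<noteq> 0 \<and> d > 0 \<and> (\<forall>i j. B (x i) (x j) = metric0 a b c d $ i $ j)"
    if ext: "trivial_extension br L64_bracket" and B: "admissible_metric br B" for B
  proof -
    obtain \<phi>' Z1' where split: "central_splitting br L64_bracket \<phi>' Z1'" using ext unfolding triv by blast
    show ?thesis
    proof (rule admissible_metric_dichotomy[OF assms(1,2) B])
      fix e assume line: "\<And>v w. \<exists>r. br v w = r *\<^sub>R e"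
      have False by (rule L64_derived_algebra_not_line[OF split line])
      then show ?thesis ..
    next
      fix x Z1 a b c d
      assume nondegenerate: "L64_basis br (span (range x)) x" "central_splitting br L64_bracket (frame_map x) Z1"
        "b \<noteq> 0" "d > 0" "\<And>i j. B (x i) (x j) = metric0 a b c d $ i $ j"
      let ?L = "span (range x)"
      have cs: "subspace Z1" "Z1 \<subseteq> lie_center br" "Z1 \<inter> ?L = {0}"
        and ex: "\<forall>v. \<exists>l. v - frame_map x l \<in> Z1"
        and hom: "\<And>u v. br (frame_map x u) (frame_map x v) = frame_map x (L64_bracket u v)"
        using nondegenerate(2) unfolding central_splitting_def range_frame_map by blast+
      have "lie_subalgebra br ?L"
        unfolding lie_subalgebra_def
      proof (intro conjI ballI subspace_span)
        fix y w assume "y \<in> ?L" "w \<in> ?L"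
        then obtain u v where "y = frame_map x u" "w = frame_map x v" unfolding range_frame_map[symmetric] by blast
        then have "br y w = frame_map x (L64_bracket u v)" by (simp add: hom)
        then show "br y w \<in> ?L" unfolding range_frame_map[symmetric] by blast
      qed
      moreover have "{z + l | z l. z \<in> Z1 \<and> l \<in> ?L} = UNIV"
      proof -
        have "v \<in> {z + l | z l. z \<in> Z1 \<and> l \<in> ?L}" for v
        proof -
          obtain l where "v - frame_map x l \<in> Z1" using ex by blast
          moreover have "frame_map x l \<in> ?L" unfolding range_frame_map[symmetric] by blast
          moreover have "v = (v - frame_map x l) + frame_map x l" by simp
          ultimately show ?thesis by blast
        qed
        then show ?thesis by blast
      qed
      ultimately show ?thesis using cs nondegenerate(1,3,4,5)
        by (intro exI[of _ Z1] exI[of _ ?L] exI[of _ x] exI[of _ a] exI[of _ b] exI[of _ c] exI[of _ d]) simp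
    qed
  qed
  show ?thesis unfolding adm using existence normal_form by blast
qed

end
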